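(* Let $\lambda>0$ and $\beta\in(0,1]$. The Wick product $(\Phi,\Psi)\mapsto\Phi\Diamond\Psi$ is a continuous mapping in $(N)^{-1}_{\pi_{\lambda,\beta}}$, and, given $p,q\in\mathbb{N}_0$, $\Phi\in(H)^{-1}_{-q,\pi_{\lambda,\beta}}$ and $\Psi\in(H)^{-1}_{-p,\pi_{\lambda,\beta}}$, $$\|\Phi\Diamond\Psi\|_{-r,-1,\pi_{\lambda,\beta}}\le\|\Phi\|_{-q,-1,\pi_{\lambda,\beta}}\,\|\Psi\|_{-p,-1,\pi_{\lambda,\beta}},\qquad r=p+q+1.$$
   Context: $\mathbb{N}_0=\{0,1,2,\dots\}$. The Mittag-Leffler function is $E_\beta(z)=\sum_{n=0}^\infty \frac{z^n}{\Gamma(\beta n+1)}$. The fractional Poisson measure $\pi_{\lambda,\beta}$ is the probability measure on $\mathbb{R}$ concentrated on $\mathbb{N}_0$ with $\pi_{\lambda,\beta}(\{k\})=\frac{\lambda^k}{k!}E_\beta^{(k)}(-\lambda)$. The generalized Appell polynomials $C_n^{\lambda,\beta}$ are defined by $\frac{e^{x\log(1+z)}}{E_\beta(\lambda z)}=\sum_{n=0}^\infty\frac{z^n}{n!}C_n^{\lambda,\beta}(x)$ for $z$ near $0$. The generalized dual Appell system $(Q_n^{\pi_{\lambda,\beta}})_{n\in\mathbb{N}_0}$ consists of the functionals on polynomials given by $\langle\!\langle\varphi,Q_n^{\pi_{\lambda,\beta}}\rangle\!\rangle_{\pi_{\lambda,\beta}}=\int_{\mathbb{R}}(\Delta^n\varphi)(x)\,\mathrm{d}\pi_{\lambda,\beta}(x)$,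 $(\Delta\varphi)(x)=\varphi(x+1)-\varphi(x)$; they satisfy $\langle\!\langle C_n^{\lambda,\beta},Q_m^{\pi_{\lambda,\beta}}\rangle\!\rangle_{\pi_{\lambda,\beta}}=n!\delta_{n,m}$. For $q\in\mathbb{N}_0$, $(H)^{-1}_{-q,\pi_{\lambda,\beta}}$ is the Hilbert space of series $\Phi=\sum_{n=0}^\infty\Phi_nQ_n^{\pi_{\lambda,\beta}}$, $\Phi_n\in\mathbb{C}$, with $\|\Phi\|^2_{-q,-1,\pi_{\lambda,\beta}}=\sum_{n=0}^\infty2^{-nq}|\Phi_n|^2<\infty$, and $(N)^{-1}_{\pi_{\lambda,\beta}}=\bigcup_{q\in\mathbb{N}_0}(H)^{-1}_{-q,\pi_{\lambda,\beta}}$ with the inductive limit topology. The Wick product of $\Phi=\sum_n\Phi_nQ_n^{\pi_{\lambda,\beta}}$ and $\Psi=\sum_n\Psi_nQ_n^{\pi_{\lambda,\beta}}$ in $(N)^{-1}_{\pi_{\lambda,\beta}}$ is the element whose $S_{\pi_{\lambda,\beta}}$-transform is the product of those of $\Phi$ and $\Psi$, where $(S_{\pi_{\lambda,\beta}}\Phi)(z)=\langle\!\langle\frac{e^{z\cdot}}{E_\beta(\lambda(e^z-1))},\Phi\rangle\!\rangle_{\pi_{\lambda,\beta}}$ for $z$ near $0$; it is represented by $$\Phi\Diamond\Psi=\sum_{n=0}^\infty\Theta_nQ_n^{\pi_{\lambda,\beta}},\qquad\Theta_n=\sum_{k=0}^n\Phi_k\Psi_{n-k}.$$ *)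

theory Defs
  imports "HOL-Analysis.Analysis"
begin

definition mittag_leffler :: "real \<Rightarrow> 'a::{real_normed_field, banach} \<Rightarrow> 'a" where
  "mittag_leffler \<beta> z = (\<Sum>n. z ^ n / of_real (Gamma (\<beta> * real n + 1)))"

text \<open>
  The push-forward to the real line of the point masses on the natural numbers. For
  \<open>lam > 0\<close> and \<open>0 < \<beta> \<le> 1\<close> the masses are nonnegative (the function
  \<open>x \<mapsto> mittag_leffler \<beta> (- x)\<close> is completely monotone), so \<open>ennreal\<close> cuts nothing off.
\<close>

definition frac_poisson :: "real \<Rightarrow> real \<Rightarrow> real measure" where
  "frac_poisson lam \<beta> =
     distr (density (count_space UNIV)
              (\<lambda>k. ennreal (lam ^ k / fact k * (deriv ^^ k) (mittag_leffler \<beta>) (- lam))))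
           borel (\<lambda>k::nat. real k)"

definition forward_diff :: "(real \<Rightarrow> complex) \<Rightarrow> real \<Rightarrow> complex" where
  "forward_diff f = (\<lambda>x. f (x + 1) - f x)"

text \<open>
  The \<open>n\<close>-th dual Appell functional. It is used on polynomials, and, in the S-transform,
  on normalised exponentials, so its argument is a function.
\<close>

definition dual_appell :: "real \<Rightarrow> real \<Rightarrow> nat \<Rightarrow> (real \<Rightarrow> complex) \<Rightarrow> complex" where
  "dual_appell lam \<beta> n f = lebesgue_integral (frac_poisson lam \<beta>) ((forward_diff ^^ n) f)"

text \<open>
  Generalised functions are linear functionals on polynomials. The series below has only
  finitely many nonzero terms for each polynomial \<open>f\<close>, since the \<open>n\<close>-th difference of \<open>f\<close>
  vanishes for \<open>n > degree f\<close>; hence it makes sense for every coefficient sequence.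
\<close>

type_synonym gen_fun = "complex poly \<Rightarrow> complex"

definition dual_series :: "real \<Rightarrow> real \<Rightarrow> (nat \<Rightarrow> complex) \<Rightarrow> gen_fun" where
  "dual_series lam \<beta> a =
     (\<lambda>f. \<Sum>n. a n * dual_appell lam \<beta> n (\<lambda>x. poly f (of_real x)))"

definition dual_coeff :: "real \<Rightarrow> real \<Rightarrow> gen_fun \<Rightarrow> nat \<Rightarrow> complex" where
  "dual_coeff lam \<beta> \<Phi> = (THE a. \<Phi> = dual_series lam \<beta> a)"

definition H_neg :: "real \<Rightarrow> real \<Rightarrow> nat \<Rightarrow> gen_fun set" where
  "H_neg lam \<beta> q =
     {dual_series lam \<beta> a | a. summable (\<lambda>n. (1 / 2) ^ (n * q) * (cmod (a n))\<^sup>2)}"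

definition H_norm :: "real \<Rightarrow> real \<Rightarrow> nat \<Rightarrow> gen_fun \<Rightarrow> real" where
  "H_norm lam \<beta> q \<Phi> =
     sqrt (\<Sum>n. (1 / 2) ^ (n * q) * (cmod (dual_coeff lam \<beta> \<Phi> n))\<^sup>2)"

definition N_neg :: "real \<Rightarrow> real \<Rightarrow> gen_fun set" where
  "N_neg lam \<beta> = (\<Union>q. H_neg lam \<beta> q)"

text \<open>
  The inductive limit topology is that of locally convex spaces, i.e. the finest locally
  convex topology for which all inclusions of the Hilbert spaces \<open>H_neg lam \<beta> q\<close> are
  continuous. A base at \<open>0\<close> is formed by the absolutely convex sets that meet every
  \<open>H_neg lam \<beta> q\<close> in a neighbourhood of \<open>0\<close> for its norm.
\<close>

definition absolutely_convex :: "gen_fun set \<Rightarrow> bool" where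
  "absolutely_convex V \<longleftrightarrow>
     (\<forall>\<Phi>\<in>V. \<forall>\<Psi>\<in>V. \<forall>a b. cmod a + cmod b \<le> 1 \<longrightarrow> (\<lambda>f. a * \<Phi> f + b * \<Psi> f) \<in> V)"

definition ind_lim_zero_nhd :: "real \<Rightarrow> real \<Rightarrow> gen_fun set \<Rightarrow> bool" where
  "ind_lim_zero_nhd lam \<beta> V \<longleftrightarrow>
     V \<subseteq> N_neg lam \<beta> \<and> absolutely_convex V \<and>
     (\<forall>q. \<exists>\<epsilon>>0. {\<Phi> \<in> H_neg lam \<beta> q. H_norm lam \<beta> q \<Phi> < \<epsilon>} \<subseteq> V)"

definition ind_lim_open :: "real \<Rightarrow> real \<Rightarrow> gen_fun set \<Rightarrow> bool" where
  "ind_lim_open lam \<beta> U \<longleftrightarrow>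
     U \<subseteq> N_neg lam \<beta> \<and>
     (\<forall>\<Phi>\<in>U. \<exists>V. ind_lim_zero_nhd lam \<beta> V \<and> (\<forall>\<Psi>\<in>V. (\<lambda>f. \<Phi> f + \<Psi> f) \<in> U))"

definition ind_lim_topology :: "real \<Rightarrow> real \<Rightarrow> gen_fun topology" where
  "ind_lim_topology lam \<beta> = topology (ind_lim_open lam \<beta>)"

lemma ind_lim_zero_nhd_Int:
  assumes "ind_lim_zero_nhd lam \<beta> V" "ind_lim_zero_nhd lam \<beta> W"
  shows "ind_lim_zero_nhd lam \<beta> (V \<inter> W)"
proof -
  have "\<exists>\<epsilon>>0. {\<Phi> \<in> H_neg lam \<beta> q. H_norm lam \<beta> q \<Phi> < \<epsilon>} \<subseteq> V \<inter> W" for q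
  proof -
    obtain d e where "d > 0" "{\<Phi> \<in> H_neg lam \<beta> q. H_norm lam \<beta> q \<Phi> < d} \<subseteq> V"
      and "e > 0" "{\<Phi> \<in> H_neg lam \<beta> q. H_norm lam \<beta> q \<Phi> < e} \<subseteq> W"
      using assms unfolding ind_lim_zero_nhd_def by blast
    then show ?thesis
      by (intro exI[of _ "min d e"]) auto
  qed
  moreover have "absolutely_convex (V \<inter> W)"
    using assms unfolding ind_lim_zero_nhd_def absolutely_convex_def by blast
  ultimately show ?thesis
    using assms unfolding ind_lim_zero_nhd_def by blast
qed

lemma istopology_ind_lim_open: "istopology (ind_lim_open lam \<beta>)"
  unfolding istopology_def
proof (intro conjI allI impI)
  fix S T assume S: "ind_lim_open lam \<beta> S" and T: "ind_lim_open lam \<beta> T"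
  show "ind_lim_open lam \<beta> (S \<inter> T)"
    unfolding ind_lim_open_def
  proof (intro conjI ballI)
    show "S \<inter> T \<subseteq> N_neg lam \<beta>"
      using S unfolding ind_lim_open_def by blast
    fix \<Phi> assume \<Phi>: "\<Phi> \<in> S \<inter> T"
    obtain V W where "ind_lim_zero_nhd lam \<beta> V" "\<forall>\<Psi>\<in>V. (\<lambda>f. \<Phi> f + \<Psi> f) \<in> S"
      "ind_lim_zero_nhd lam \<beta> W" "\<forall>\<Psi>\<in>W. (\<lambda>f. \<Phi> f + \<Psi> f) \<in> T"
      using S T \<Phi> unfolding ind_lim_open_def by blast
    then show "\<exists>V. ind_lim_zero_nhd lam \<beta> V \<and> (\<forall>\<Psi>\<in>V. (\<lambda>f. \<Phi> f + \<Psi> f) \<in> S \<inter> T)"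
      by (intro exI[of _ "V \<inter> W"]) (auto intro: ind_lim_zero_nhd_Int)
  qed
next
  fix \<K> assume K: "\<forall>K\<in>\<K>. ind_lim_open lam \<beta> K"
  show "ind_lim_open lam \<beta> (\<Union>\<K>)"
    unfolding ind_lim_open_def
  proof (intro conjI ballI)
    show "\<Union>\<K> \<subseteq> N_neg lam \<beta>"
      using K unfolding ind_lim_open_def by blast
    fix \<Phi> assume "\<Phi> \<in> \<Union>\<K>"
    then obtain U where U: "U \<in> \<K>" "\<Phi> \<in> U" by blast
    then obtain V where "ind_lim_zero_nhd lam \<beta> V" "\<forall>\<Psi>\<in>V. (\<lambda>f. \<Phi> f + \<Psi> f) \<in> U"
      using K unfolding ind_lim_open_def by blast
    with U show "\<exists>V. ind_lim_zero_nhd lam \<beta> V \<and> (\<forall>\<Psi>\<in>V. (\<lambda>f. \<Phi> f + \<Psi> f) \<in> \<Union>\<K>)"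
      by blast
  qed
qed

lemma openin_ind_lim_topology: "openin (ind_lim_topology lam \<beta>) = ind_lim_open lam \<beta>"
  unfolding ind_lim_topology_def by (rule topology_inverse'[OF istopology_ind_lim_open])

text \<open>
  The pairing of a generalised function with a normalised exponential is taken term by term
  in the series of dual Appell functionals. It converges for \<open>z\<close> near \<open>0\<close>.
\<close>

definition S_transform :: "real \<Rightarrow> real \<Rightarrow> gen_fun \<Rightarrow> complex \<Rightarrow> complex" where
  "S_transform lam \<beta> \<Phi> z =
     (\<Sum>n. dual_coeff lam \<beta> \<Phi> n *
           dual_appell lam \<beta> n
             (\<lambda>x. exp (z * of_real x) / mittag_leffler \<beta> (of_real lam * (exp z - 1))))"

definition wick :: "real \<Rightarrow> real \<Rightarrow> gen_fun \<Rightarrow> gen_fun \<Rightarrow> gen_fun" where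
  "wick lam \<beta> \<Phi> \<Psi> =
     (THE \<Theta>. \<Theta> \<in> N_neg lam \<beta> \<and>
        (\<forall>\<^sub>F z in nhds 0.
           S_transform lam \<beta> \<Theta> z = S_transform lam \<beta> \<Phi> z * S_transform lam \<beta> \<Psi> z))"

end

theory Submission
  imports Defs "HOL-Complex_Analysis.Cauchy_Integral_Formula" "HOL-Real_Asymp.Real_Asymp"
begin

text \<open>
  The coefficient sequence determines a generalised function, and its S-transform is the power
  series of that sequence at \<open>e\<^sup>z - 1\<close>; hence the Wick product is the Cauchy product of coefficient
  sequences, and the norm estimate is the Cauchy--Schwarz inequality together with \<open>n + 1 \<le> 2\<^sup>n\<close>.
  All of this requires that the masses of the fractional Poisson measure are nonnegative, i.e. that
  the Mittag-Leffler function is completely monotone on the negative axis. This is obtained by a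
  discrete approximation: \<open>n\<^sup>-\<^sup>\<beta>\<^sup>k\<close> times the \<open>n\<close>-th Taylor coefficient of
  \<open>(1 - x)\<^sup>\<beta>\<^sup>-\<^sup>1 / ((1 - x)\<^sup>\<beta> + h)\<^sup>k\<^sup>+\<^sup>1\<close>, \<open>h = \<lambda> n\<^sup>-\<^sup>\<beta>\<close>, is nonnegative and tends to
  \<open>E\<^sub>\<beta>\<^sup>(\<^sup>k\<^sup>)(-\<lambda>) / k!\<close>. Joint continuity of the product follows from the norm estimate, since the
  absolutely convex hulls of the balls of radius \<open>\<delta>\<^sub>q\<close> in the \<open>q\<close>-th spaces are neighbourhoods of \<open>0\<close>
  and the \<open>\<delta>\<^sub>q\<close> may be chosen freely.
\<close>

section \<open>Complete monotonicity of the Mittag-Leffler function\<close>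

unbundle fps_syntax

text \<open>The series \<open>(1 - X)\<^sup>-\<^sup>c\<close>.\<close>

definition neg_binomial_fps :: "real \<Rightarrow> real fps" where
  "neg_binomial_fps c = Abs_fps (\<lambda>n. pochhammer c n / fact n)"

lemma neg_binomial_fps_nth: "neg_binomial_fps c $ n = pochhammer c n / fact n"
  by (simp add: neg_binomial_fps_def)

text \<open>Coefficientwise this is the Vandermonde identity for rising factorials.\<close>

lemma neg_binomial_fps_add:
  "neg_binomial_fps (c + d) = neg_binomial_fps c * neg_binomial_fps d"
proof (rule fps_ext)
  fix n
  have "neg_binomial_fps (c + d) $ n
      = (\<Sum>k\<le>n. of_nat (n choose k) * pochhammer c k * pochhammer d (n - k)) / fact n"
    by (simp add: neg_binomial_fps_nth pochhammer_binomial_sum)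
  also have "\<dots> = (\<Sum>k\<le>n. (pochhammer c k / fact k) * (pochhammer d (n - k) / fact (n - k)))"
    unfolding sum_divide_distrib
    by (rule sum.cong) (auto simp: binomial_fact field_simps)
  finally show "neg_binomial_fps (c + d) $ n = (neg_binomial_fps c * neg_binomial_fps d) $ n"
    by (simp add: fps_mult_nth neg_binomial_fps_nth atLeast0AtMost)
qed

lemma pochhammer_real_nonneg: "c \<ge> 0 \<Longrightarrow> pochhammer (c::real) n \<ge> 0"
  by (induction n) (auto simp: pochhammer_Suc)

lemma neg_binomial_fps_nonneg: "c \<ge> 0 \<Longrightarrow> neg_binomial_fps c $ n \<ge> 0"
  by (simp add: neg_binomial_fps_nth pochhammer_real_nonneg)

text \<open>For positive n the rising factorial of -b is -b times that of 1 - b, and the latter has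
  no negative factor.\<close>

lemma neg_binomial_fps_nonpos:
  assumes "0 \<le> b" "b \<le> 1" "n > 0"
  shows "neg_binomial_fps (- b) $ n \<le> 0"
proof -
  obtain m where m: "n = Suc m" using assms by (cases n) auto
  have "pochhammer (1 - b) m \<ge> 0" using assms by (intro pochhammer_real_nonneg) auto
  then show ?thesis
    using assms by (simp add: neg_binomial_fps_nth m pochhammer_rec divide_nonpos_pos)
qed

text \<open>Solving the n-th coefficient of \<open>Q * F\<close> for \<open>F $ n\<close> leaves a
  nonnegative term minus products of nonpositive \<open>Q $ i\<close> with earlier coefficients of
  \<open>F\<close>. It is applied with \<open>Q\<close> the series (1 - X)^b + h.\<close>

lemma fps_quotient_nonneg:
  fixes Q F :: "real fps"
  assumes "Q $ 0 > 0" "\<And>n. n > 0 \<Longrightarrow> Q $ n \<le> 0" "\<And>n. (Q * F) $ n \<ge> 0"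
  shows "F $ n \<ge> 0"
proof (induction n rule: less_induct)
  case (less n)
  have "(Q * F) $ n = Q $ 0 * F $ n + (\<Sum>i=1..n. Q $ i * F $ (n - i))"
    by (simp add: fps_mult_nth sum.atLeast_Suc_atMost)
  moreover have "(\<Sum>i=1..n. Q $ i * F $ (n - i)) \<le> 0"
    using assms(2) less by (intro sum_nonpos mult_nonpos_nonneg) auto
  ultimately have "Q $ 0 * F $ n \<ge> 0" using assms(3)[of n] by linarith
  then show ?case using assms(1) by (simp add: zero_le_mult_iff)
qed

section \<open>Normalised rising factorials and their limit, the reciprocal Gamma function\<close>

lemma pochhammer_over_fact_eq_prod:
  fixes a :: real
  shows "pochhammer (a + 1) n / fact n = (\<Prod>i=1..n. 1 + a / real i)"
proof (induction n)
  case (Suc n)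
  have "pochhammer (a + 1) (Suc n) / fact (Suc n)
      = (pochhammer (a + 1) n / fact n) * ((a + 1 + real n) / real (Suc n))"
    by (simp add: pochhammer_Suc)
  also have "(a + 1 + real n) / real (Suc n) = 1 + a / real (Suc n)"
    by (simp add: field_simps)
  finally show ?case by (simp add: Suc)
qed auto

lemma pochhammer_over_fact_le:
  assumes "(a::real) \<ge> 0"
  shows "pochhammer (a + 1) n / fact n \<le> (1 + a) ^ n"
proof -
  have "(\<Prod>i=1..n. 1 + a / real i) \<le> (\<Prod>i=1..n. 1 + a)"
  proof (intro prod_mono conjI)
    fix i assume "i \<in> {1..n}"
    then have "a / real i \<le> a / 1" using assms by (intro divide_left_mono) auto
    then show "1 + a / real i \<le> 1 + a" by simp
  qed (use assms in auto)
  then show ?thesis by (simp add: pochhammer_over_fact_eq_prod)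
qed

text \<open>
  Converges to \<open>1 / Gamma (a + 1)\<close> and decreases in \<open>n\<close>; its value at a fixed \<open>n = m\<close> serves as the
  dominating term, geometrically small in \<open>a\<close> with a ratio that \<open>m\<close> makes arbitrarily small.
\<close>

definition Gamma_quotient :: "real \<Rightarrow> nat \<Rightarrow> real" where
  "Gamma_quotient a n = pochhammer (a + 1) n / fact n / real n powr a"

lemma Gamma_quotient_nonneg: "a \<ge> 0 \<Longrightarrow> Gamma_quotient a n \<ge> 0"
  by (simp add: Gamma_quotient_def pochhammer_real_nonneg)

text \<open>The ratio of consecutive terms is (1 + a/(n+1)) (n/(n+1))^a. It is at most 1 because 1 +
  x <= exp x and ln (1 - 1/(n+1)) <= -1/(n+1).\<close>

lemma Gamma_quotient_Suc_le:
  assumes "a \<ge> 0" "n \<ge> 1"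
  shows "Gamma_quotient a (Suc n) \<le> Gamma_quotient a n"
proof -
  have "ln (1 - 1 / real (Suc n)) \<le> - (1 / real (Suc n))"
    using assms ln_le_minus_one[of "1 - 1 / real (Suc n)"] by simp
  moreover have "ln (1 - 1 / real (Suc n)) = ln (real n) - ln (real (Suc n))"
  proof -
    have "1 - 1 / real (Suc n) = real n / real (Suc n)" by (simp add: field_simps)
    then show ?thesis using assms by (simp only: ln_div) simp
  qed
  ultimately have "1 / real (Suc n) \<le> ln (real (Suc n)) - ln (real n)" by linarith
  then have "a / real (Suc n) \<le> a * (ln (real (Suc n)) - ln (real n))"
    using assms mult_left_mono[of "1 / real (Suc n)" _ a] by simp
  then have "1 + a / real (Suc n) \<le> exp (a * (ln (real (Suc n)) - ln (real n)))"
    using exp_ge_add_one_self[of "a * (ln (real (Suc n)) - ln (real n))"] by linarith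
  also have "\<dots> = real (Suc n) powr a / real n powr a"
    using assms by (simp add: powr_def exp_diff algebra_simps)
  finally have *: "1 + a / real (Suc n) \<le> real (Suc n) powr a / real n powr a" .
  have "Gamma_quotient a (Suc n)
      = pochhammer (a + 1) n / fact n * (1 + a / real (Suc n)) / real (Suc n) powr a"
    by (simp only: Gamma_quotient_def pochhammer_over_fact_eq_prod) simp
  also have "\<dots> \<le> pochhammer (a + 1) n / fact n * (real (Suc n) powr a / real n powr a)
      / real (Suc n) powr a"
    using * assms by (intro divide_right_mono mult_left_mono) (auto simp: pochhammer_real_nonneg)
  also have "\<dots> = Gamma_quotient a n"
    by (simp add: Gamma_quotient_def)
  finally show ?thesis .
qed

text \<open>Monotonicity moves the index down to \<open>m\<close>, where the product form has
  \<open>m\<close> factors, each at most 1 + a. The bound is uniform in \<open>n\<close>, as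
  dominated convergence requires.\<close>

lemma Gamma_quotient_le:
  assumes "a \<ge> 0" "m \<ge> 1" "m \<le> n"
  shows "Gamma_quotient a n \<le> (1 + a) ^ m / real m powr a"
proof -
  have "Gamma_quotient a n \<le> Gamma_quotient a m"
    using assms(3)
  proof (induction n rule: dec_induct)
    case (step n)
    then show ?case using Gamma_quotient_Suc_le[of a n] assms by linarith
  qed auto
  also have "\<dots> \<le> (1 + a) ^ m / real m powr a"
    unfolding Gamma_quotient_def using assms by (intro divide_right_mono pochhammer_over_fact_le) auto
  finally show ?thesis .
qed

lemma Gamma_quotient_tendsto:
  assumes "a \<ge> 0"
  shows "Gamma_quotient a \<longlonglongrightarrow> 1 / Gamma (a + 1)"
proof -
  \<comment> \<open>\<open>rGamma_series (a + 1)\<close> carries one more rising factor and one more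
    power of n than \<open>Gamma_quotient a\<close>; this quotient corrects for both.\<close>
  have "(\<lambda>n. real n / (real n + (a + 1))) \<longlonglongrightarrow> 1"
    by real_asymp
  then have "(\<lambda>n. rGamma_series (a + 1) n * (real n / (real n + (a + 1)))) \<longlonglongrightarrow> rGamma (a + 1) * 1"
    by (intro tendsto_intros)
  moreover have "\<forall>\<^sub>F n in sequentially.
      rGamma_series (a + 1) n * (real n / (real n + (a + 1))) = Gamma_quotient a n"
    using eventually_gt_at_top[of 0]
  proof eventually_elim
    case (elim n)
    have "rGamma_series (a + 1) n
        = pochhammer (a + 1) n * (real n + (a + 1)) / (fact n * (real n powr a * real n))"
      using elim by (simp add: rGamma_series_def pochhammer_Suc powr_def algebra_simps exp_add)
    moreover have "real n + (a + 1) > 0" using assms by linarith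
    ultimately show ?case
      using elim by (simp add: Gamma_quotient_def)
  qed
  ultimately have "Gamma_quotient a \<longlonglongrightarrow> rGamma (a + 1) * 1"
    using tendsto_cong by fastforce
  then show ?thesis by (simp add: rGamma_inverse_Gamma divide_inverse)
qed

lemma inverse_Gamma_le:
  assumes "a \<ge> 0" "m \<ge> 1"
  shows "1 / Gamma (a + 1) \<le> (1 + a) ^ m / real m powr a"
proof (rule tendsto_upperbound[OF Gamma_quotient_tendsto[OF assms(1)]])
  show "\<forall>\<^sub>F n in sequentially. Gamma_quotient a n \<le> (1 + a) ^ m / real m powr a"
    using eventually_ge_at_top[of m] by eventually_elim (use assms Gamma_quotient_le in auto)
qed auto

section \<open>Polynomial times geometric series as dominating series\<close>

lemma summable_poly_geometric:
  fixes y :: real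
  assumes "0 \<le> c" "0 \<le> y" "y < 1"
  shows "summable (\<lambda>j. (c + real j) ^ p * y ^ j)"
proof -
  have *: "norm x < 1 \<Longrightarrow> summable (\<lambda>j. (1 + real j) ^ p * x ^ j)" for x :: real
  proof (induction p arbitrary: x)
    case 0
    then show ?case by (simp add: summable_geometric)
  next
    case (Suc p)
    \<comment> \<open>Termwise differentiation raises the degree: the differentiated series has
      coefficients (1 + j) (2 + j)^p, which dominate (1 + j)^(p + 1).\<close>
    have "summable (\<lambda>j. diffs (\<lambda>j. (1 + real j) ^ p) j * \<bar>x\<bar> ^ j)"
      by (rule termdiff_converges[of _ 1]) (use Suc in auto)
    then show ?case
    proof (rule summable_comparison_test')
      fix j
      have "(1 + real j) * (1 + real j) ^ p \<le> (1 + real j) * (2 + real j) ^ p"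
        by (intro mult_left_mono power_mono) auto
      then show "norm ((1 + real j) ^ Suc p * x ^ j) \<le> diffs (\<lambda>j. (1 + real j) ^ p) j * \<bar>x\<bar> ^ j"
        by (auto simp: diffs_def abs_mult power_abs intro!: mult_right_mono)
    qed
  qed
  have "summable (\<lambda>j. (1 + c) ^ p * ((1 + real j) ^ p * y ^ j))"
    by (intro summable_mult *) (use assms in auto)
  then show ?thesis
  proof (rule summable_comparison_test')
    fix j
    have "c + real j \<le> (1 + c) * (1 + real j)"
      using assms by (simp add: algebra_simps)
    then have "(c + real j) ^ p \<le> ((1 + c) * (1 + real j)) ^ p"
      using assms by (intro power_mono) auto
    then show "norm ((c + real j) ^ p * y ^ j) \<le> (1 + c) ^ p * ((1 + real j) ^ p * y ^ j)"
      using assms mult_right_mono[of "(c + real j) ^ p" "((1 + c) * (1 + real j)) ^ p" "y ^ j"]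
      by (simp add: power_mult_distrib mult.assoc)
  qed
qed

lemma binomial_add_le_power: "real ((k + j) choose j) \<le> (1 + real k + real j) ^ k"
proof -
  have "(k + j) choose j = (k + j) choose k" using binomial_symmetric[of j "k + j"] by simp
  also have "\<dots> \<le> (k + j) ^ k" by (rule binomial_le_pow) simp
  finally have "real ((k + j) choose j) \<le> real ((k + j) ^ k)" by (rule of_nat_mono)
  also have "\<dots> = (real k + real j) ^ k" by simp
  also have "(real k + real j) ^ k \<le> (1 + real k + real j) ^ k" by (intro power_mono) auto
  finally show ?thesis .
qed

text \<open>For fixed \<open>k\<close> and \<open>m\<close> both factors in front of y^j are bounded
  by powers of 1 + k + j. This series dominates the expansion in powers of h, the approximants in
  the limit passage and, with k = 0, the Mittag-Leffler series itself.\<close>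

lemma summable_binomial_poly_geometric:
  fixes b y :: real
  assumes "0 \<le> b" "b \<le> 1" "0 \<le> y" "y < 1"
  shows "summable (\<lambda>j. real ((k + j) choose j) * (1 + b * real (k + j)) ^ m * y ^ j)"
proof (rule summable_comparison_test')
  show "summable (\<lambda>j. ((1 + real k) + real j) ^ (k + m) * y ^ j)"
    by (rule summable_poly_geometric) (use assms in auto)
  fix j
  have "b * real (k + j) \<le> real (k + j)" using assms by (intro mult_left_le_one_le) auto
  then have "(1 + b * real (k + j)) ^ m \<le> (1 + real k + real j) ^ m"
    using assms by (intro power_mono) auto
  then have "real ((k + j) choose j) * (1 + b * real (k + j)) ^ m
      \<le> (1 + real k + real j) ^ k * (1 + real k + real j) ^ m"
    using assms by (intro mult_mono binomial_add_le_power) auto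
  then show "norm (real ((k + j) choose j) * (1 + b * real (k + j)) ^ m * y ^ j)
      \<le> ((1 + real k) + real j) ^ (k + m) * y ^ j"
    using assms by (auto simp: power_add abs_mult intro!: mult_right_mono)
qed


section \<open>The expansion in powers of h and the signs of its coefficients\<close>

lemma summable_neg_binomial_series:
  fixes b h :: real
  assumes "0 \<le> b" "b \<le> 1" "0 \<le> h" "h < 1"
  shows "summable (\<lambda>j. real ((k + j) choose j) * (- h) ^ j
           * neg_binomial_fps (b * real (k + j) + 1) $ n)"
proof (rule summable_comparison_test')
  show "summable (\<lambda>j. real ((k + j) choose j) * (1 + b * real (k + j)) ^ n * h ^ j)"
    by (rule summable_binomial_poly_geometric) (use assms in auto)
  fix j
  have "neg_binomial_fps (b * real (k + j) + 1) $ n \<le> (1 + b * real (k + j)) ^ n"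
    unfolding neg_binomial_fps_nth by (rule pochhammer_over_fact_le) (use assms in auto)
  moreover have "neg_binomial_fps (b * real (k + j) + 1) $ n \<ge> 0"
    by (rule neg_binomial_fps_nonneg) (use assms in auto)
  ultimately show "norm (real ((k + j) choose j) * (- h) ^ j * neg_binomial_fps (b * real (k + j) + 1) $ n)
      \<le> real ((k + j) choose j) * (1 + b * real (k + j)) ^ n * h ^ j"
    using assms
    by (auto simp: abs_mult power_abs mult.assoc mult.commute[of "h ^ j"]
        intro!: mult_left_mono mult_right_mono)
qed

text \<open>
  \<open>F k\<close> is \<open>(1 - X)\<^sup>b\<^sup>-\<^sup>1 / ((1 - X)\<^sup>b + h)\<^sup>k\<^sup>+\<^sup>1\<close>, expanded in powers of \<open>h\<close>.
\<close>

lemma neg_binomial_series_mult: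
  fixes b h :: real
  assumes "0 \<le> b" "b \<le> 1" "0 \<le> h" "h < 1"
  defines "F \<equiv> \<lambda>k. Abs_fps (\<lambda>n. \<Sum>j. real ((k + j) choose j) * (- h) ^ j
           * neg_binomial_fps (b * real (k + j) + 1) $ n)"
  shows "(neg_binomial_fps (- b) + fps_const h) * F k
       = (if k = 0 then neg_binomial_fps (1 - b) else F (k - 1))"
proof (rule fps_ext)
  fix n
  define c where "c k j = real ((k + j) choose j) * (- h) ^ j" for k j
  define f where "f j = c k j * neg_binomial_fps (b * real (k + j) + 1 - b) $ n" for j
  define g where "g j = h * (c k j * neg_binomial_fps (b * real (k + j) + 1) $ n)" for j
  have sF: "summable (\<lambda>j. c k j * neg_binomial_fps (b * real (k + j) + 1) $ n)" for k n
    unfolding c_def by (rule summable_neg_binomial_series) (use assms in auto)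
  have "(neg_binomial_fps (- b) * F k) $ n
      = (\<Sum>i=0..n. neg_binomial_fps (- b) $ i
           * (\<Sum>j. c k j * neg_binomial_fps (b * real (k + j) + 1) $ (n - i)))"
    by (simp add: fps_mult_nth F_def c_def)
  also have "\<dots> = (\<Sum>i=0..n. \<Sum>j. neg_binomial_fps (- b) $ i
           * (c k j * neg_binomial_fps (b * real (k + j) + 1) $ (n - i)))"
    by (simp only: suminf_mult[OF sF])
  also have "\<dots> = (\<Sum>j. \<Sum>i=0..n. neg_binomial_fps (- b) $ i
           * (c k j * neg_binomial_fps (b * real (k + j) + 1) $ (n - i)))"
    by (rule suminf_sum[symmetric]) (intro summable_mult sF)
  \<comment> \<open>Multiplication by (1 - X)^b lowers every exponent by b, so the term with index j
    + 1 acquires the exponent that the j-th term had before.\<close>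
  also have eq: "(\<lambda>j. \<Sum>i=0..n. neg_binomial_fps (- b) $ i
           * (c k j * neg_binomial_fps (b * real (k + j) + 1) $ (n - i))) = f"
  proof
    fix j
    have "neg_binomial_fps (b * real (k + j) + 1 - b)
        = neg_binomial_fps (- b) * neg_binomial_fps (b * real (k + j) + 1)"
      by (subst neg_binomial_fps_add[symmetric]) (simp add: algebra_simps)
    then show "(\<Sum>i=0..n. neg_binomial_fps (- b) $ i
           * (c k j * neg_binomial_fps (b * real (k + j) + 1) $ (n - i))) = f j"
      by (simp add: f_def fps_mult_nth sum_distrib_left mult_ac)
  qed
  finally have 1: "(neg_binomial_fps (- b) * F k) $ n = suminf f" .
  have sf: "summable f"
    unfolding eq[symmetric] by (intro summable_sum summable_mult sF)
  have sg: "summable g"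
    unfolding g_def by (intro summable_mult sF)
  have 2: "(fps_const h * F k) $ n = suminf g"
    by (simp only: g_def[abs_def] suminf_mult[OF sF]) (simp add: F_def c_def)
  \<comment> \<open>With the shift by one, \<open>f (Suc j)\<close> and \<open>g j\<close> carry the
    same power of h and the same exponent with opposite signs. Pascal's rule leaves a single
    binomial coefficient, which vanishes for k = 0 and belongs to \<open>F (k - 1)\<close>
    otherwise.\<close>
  have fg: "f (Suc j) + g j
      = real ((k + j) choose Suc j) * (- h) ^ Suc j * neg_binomial_fps (b * real (k + j) + 1) $ n" for j
    by (simp add: f_def g_def c_def algebra_simps)
  have "((neg_binomial_fps (- b) + fps_const h) * F k) $ n = suminf f + suminf g"
    by (simp only: distrib_right fps_add_nth 1 2)
  also have "\<dots> = f 0 + (\<Sum>j. f (Suc j)) + suminf g"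
    using suminf_split_head[OF sf] by simp
  also have "\<dots> = f 0 + (\<Sum>j. f (Suc j) + g j)"
    using suminf_add[of "\<lambda>j. f (Suc j)" g] sf sg by (simp add: summable_Suc_iff)
  also have "\<dots> = (if k = 0 then neg_binomial_fps (1 - b) else F (k - 1)) $ n"
  proof (cases k)
    case 0
    then show ?thesis unfolding fg by (simp add: f_def c_def binomial_eq_0)
  next
    case (Suc k')
    define u where "u j = c k' j * neg_binomial_fps (b * real (k' + j) + 1) $ n" for j
    have "f (Suc j) + g j = u (Suc j)" for j
      unfolding fg by (simp add: Suc u_def c_def)
    moreover have "f 0 = u 0"
      by (simp add: f_def u_def c_def Suc algebra_simps)
    moreover have "summable u" unfolding u_def by (rule sF)
    ultimately have "f 0 + (\<Sum>j. f (Suc j) + g j) = suminf u"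
      using suminf_split_head[of u] by simp
    then show ?thesis by (simp add: Suc F_def u_def[abs_def] c_def)
  qed
  finally show "((neg_binomial_fps (- b) + fps_const h) * F k) $ n
       = (if k = 0 then neg_binomial_fps (1 - b) else F (k - 1)) $ n" .
qed

text \<open>Induction on \<open>k\<close>: each step divides by (1 - X)^b + h, whose constant
  coefficient is 1 + h and whose other coefficients are nonpositive. The induction starts from (1 -
  X)^(b - 1), which has nonnegative coefficients.\<close>

lemma neg_binomial_series_nonneg:
  fixes b h :: real
  assumes "0 \<le> b" "b \<le> 1" "0 \<le> h" "h < 1"
  shows "(\<Sum>j. real ((k + j) choose j) * (- h) ^ j
           * neg_binomial_fps (b * real (k + j) + 1) $ n) \<ge> 0"
proof -
  define F where "F \<equiv> \<lambda>k. Abs_fps (\<lambda>n. \<Sum>j. real ((k + j) choose j) * (- h) ^ j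
           * neg_binomial_fps (b * real (k + j) + 1) $ n)"
  have mult: "(neg_binomial_fps (- b) + fps_const h) * F 0 = neg_binomial_fps (1 - b)"
    "(neg_binomial_fps (- b) + fps_const h) * F (Suc k) = F k" for k
    unfolding F_def by (subst neg_binomial_series_mult[OF assms]; simp)+
  have "F k $ n \<ge> 0"
  proof (induction k arbitrary: n)
    case 0
    show ?case
      by (rule fps_quotient_nonneg[of "neg_binomial_fps (- b) + fps_const h"])
        (use assms neg_binomial_fps_nonpos neg_binomial_fps_nonneg
          in \<open>auto simp: mult neg_binomial_fps_nth[of _ 0]\<close>)
  next
    case (Suc k)
    show ?case
      by (rule fps_quotient_nonneg[of "neg_binomial_fps (- b) + fps_const h"])
        (use assms neg_binomial_fps_nonpos Suc
          in \<open>auto simp: mult neg_binomial_fps_nth[of _ 0]\<close>)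
  qed
  then show ?thesis by (simp add: F_def)
qed

section \<open>Limit passage to the derivatives of the Mittag-Leffler function\<close>

lemma Prabhakar_series_nonneg:
  fixes b lam :: real
  assumes b: "0 < b" "b \<le> 1" and lam: "lam > 0"
  shows "(\<Sum>j. real ((k + j) choose j) * (- lam) ^ j / Gamma (b * real (k + j) + 1)) \<ge> 0"
proof -
  have "\<forall>\<^sub>F n::nat in sequentially. lam / real n powr b < 1 \<and> n \<ge> 1"
  proof -
    have "(\<lambda>n. real n powr - b) \<longlonglongrightarrow> 0"
      using b by (intro tendsto_neg_powr filterlim_real_sequentially) auto
    then have "(\<lambda>n. lam * real n powr - b) \<longlonglongrightarrow> lam * 0"
      by (intro tendsto_intros)
    then have "\<forall>\<^sub>F n in sequentially. lam * real n powr - b < 1"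
      by (rule order_tendstoD) simp
    then show ?thesis
      using eventually_ge_at_top[of 1]
      by eventually_elim (simp add: powr_minus divide_inverse)
  qed
  \<comment> \<open>One index serves twice: for n >= m the parameter lam / n^b is below 1, so the
    sign result applies, and the value at \<open>m\<close> yields a dominating series with ratio lam
    / m^b below 1.\<close>
  then obtain m where m: "\<And>n. n \<ge> m \<Longrightarrow> lam / real n powr b < 1 \<and> n \<ge> 1"
    by (auto simp: eventually_sequentially)
  define a where "a j n = real ((k + j) choose j) * (- lam) ^ j * Gamma_quotient (b * real (k + j)) n"
    for j n
  define M where "M j = real ((k + j) choose j) * (1 + b * real (k + j)) ^ m
      * (lam / real m powr b) ^ j / real m powr (b * real k)" for j
  have powr_eq: "real n powr (b * real (k + j)) = real n powr (b * real k) * (real n powr b) ^ j"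
    if "n \<ge> 1" for n j
    using that by (simp add: distrib_left powr_add powr_powr[symmetric] powr_realpow)
  have bound: "norm (a j n) \<le> M j" if "n \<ge> m" for j n
  proof -
    have "norm (a j n) = real ((k + j) choose j) * lam ^ j * Gamma_quotient (b * real (k + j)) n"
      using b lam by (simp add: a_def abs_mult power_abs Gamma_quotient_nonneg)
    also have "\<dots> \<le> real ((k + j) choose j) * lam ^ j
        * ((1 + b * real (k + j)) ^ m / real m powr (b * real (k + j)))"
      using b lam m[of m] that by (intro mult_left_mono Gamma_quotient_le) auto
    also have "\<dots> = M j"
      using m[of m] powr_eq[of m j] by (simp only: M_def power_divide) (simp add: mult_ac)
    finally show ?thesis .
  qed
  have sum_nonneg: "(\<Sum>j. a j n) \<ge> 0" if "n \<ge> m" for n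
  proof -
    define h where "h = lam / real n powr b"
    have h: "0 \<le> h" "h < 1" using m[OF that] lam by (auto simp: h_def)
    \<comment> \<open>Since n^(b(k+j)) = n^(bk) (n^b)^j, the part of the normalisation depending on
      j turns lam into \<open>h\<close>; a positive factor free of j remains.\<close>
    have "a j n = (real ((k + j) choose j) * (- h) ^ j * neg_binomial_fps (b * real (k + j) + 1) $ n)
        / real n powr (b * real k)" for j
    proof -
      have "(- h) ^ j = (- lam) ^ j / (real n powr b) ^ j"
        unfolding h_def by (metis minus_divide_left power_divide)
      moreover have "real n powr (b * real (k + j)) = real n powr (b * real k) * (real n powr b) ^ j"
        using m[OF that] by (intro powr_eq) auto
      ultimately show ?thesis
        by (simp only: a_def Gamma_quotient_def neg_binomial_fps_nth) simp
    qed
    then have "(\<Sum>j. a j n) = (\<Sum>j. real ((k + j) choose j) * (- h) ^ j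
        * neg_binomial_fps (b * real (k + j) + 1) $ n) / real n powr (b * real k)"
      using b h by (simp only:) (intro suminf_divide summable_neg_binomial_series, auto)
    then show ?thesis
      using neg_binomial_series_nonneg[of b h k n] b h by simp
  qed
  have "(\<lambda>n. \<Sum>j. a j n) \<longlonglongrightarrow> (\<Sum>j. real ((k + j) choose j) * (- lam) ^ j
      * (1 / Gamma (b * real (k + j) + 1)))"
  \<comment> \<open>\<open>M\<close> bounds the terms uniformly for n >= m, so the limit may be
    taken inside the series.\<close>
  proof (rule tannerys_theorem[THEN conjunct2, THEN conjunct2])
    show "(\<lambda>n. a j n) \<longlonglongrightarrow> real ((k + j) choose j) * (- lam) ^ j
      * (1 / Gamma (b * real (k + j) + 1))" for j
      unfolding a_def using b by (intro tendsto_intros Gamma_quotient_tendsto) auto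
    show "summable M"
      unfolding M_def using b lam m[of m]
      by (intro summable_divide summable_binomial_poly_geometric) auto
    show "\<forall>\<^sub>F (j, n) in sequentially \<times>\<^sub>F sequentially. norm (a j n) \<le> M j"
      unfolding eventually_prod_sequentially using bound by auto
  qed auto
  then have "(\<Sum>j. real ((k + j) choose j) * (- lam) ^ j * (1 / Gamma (b * real (k + j) + 1))) \<ge> 0"
    by (rule tendsto_lowerbound) (use sum_nonneg in \<open>auto simp: eventually_sequentially\<close>)
  then show ?thesis by simp
qed

text \<open>By \<open>inverse_Gamma_le\<close>, 1 / Gamma (b n + 1) is at most a polynomial in n
  times (m^b)^-n, and \<open>m\<close> is chosen so that m^b exceeds the absolute value of
  x.\<close>

lemma summable_Mittag_Leffler:
  fixes x :: real
  assumes b: "0 < b" "b \<le> 1"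
  shows "summable (\<lambda>n. \<bar>x\<bar> ^ n / Gamma (b * real n + 1))"
proof -
  obtain m :: nat where m: "\<bar>x\<bar> / real m powr b < 1" "m \<ge> 1"
  proof -
    have "(\<lambda>n. \<bar>x\<bar> * real n powr - b) \<longlonglongrightarrow> \<bar>x\<bar> * 0"
      using b by (intro tendsto_intros tendsto_neg_powr filterlim_real_sequentially) auto
    then have "\<forall>\<^sub>F n in sequentially. \<bar>x\<bar> * real n powr - b < 1"
      by (rule order_tendstoD) simp
    then have "\<forall>\<^sub>F n in sequentially. \<bar>x\<bar> * real n powr - b < 1 \<and> n \<ge> 1"
      using eventually_ge_at_top[of 1] by eventually_elim auto
    then obtain m where "\<bar>x\<bar> * real m powr - b < 1 \<and> m \<ge> 1"
      using eventually_happens' sequentially_bot by blast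
    then show thesis by (intro that[of m]) (simp_all add: powr_minus divide_inverse)
  qed
  show ?thesis
  proof (rule summable_comparison_test')
    show "summable (\<lambda>n. real ((0 + n) choose n) * (1 + b * real (0 + n)) ^ m * (\<bar>x\<bar> / real m powr b) ^ n)"
      by (rule summable_binomial_poly_geometric) (use m b in auto)
    fix n
    have "1 / Gamma (b * real n + 1) \<le> (1 + b * real n) ^ m / real m powr (b * real n)"
      using b m by (intro inverse_Gamma_le) auto
    also have "real m powr (b * real n) = (real m powr b) ^ n"
      using m by (simp add: powr_powr[symmetric] powr_realpow)
    finally have "\<bar>x\<bar> ^ n * (1 / Gamma (b * real n + 1))
        \<le> \<bar>x\<bar> ^ n * ((1 + b * real n) ^ m / (real m powr b) ^ n)"
      by (rule mult_left_mono) simp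
    moreover have "Gamma (b * real n + 1) > 0" using b by (intro Gamma_real_pos add_nonneg_pos) auto
    ultimately show "norm (\<bar>x\<bar> ^ n / Gamma (b * real n + 1))
        \<le> real ((0 + n) choose n) * (1 + b * real (0 + n)) ^ m * (\<bar>x\<bar> / real m powr b) ^ n"
      by (simp add: power_divide mult_ac)
  qed
qed

section \<open>Moments of the fractional Poisson measure\<close>

lemma mittag_leffler_summable_norm:
  fixes z :: "'a::{real_normed_field, banach}"
  assumes "0 < b" "b \<le> 1"
  shows "summable (\<lambda>n. norm (z ^ n / of_real (Gamma (b * real n + 1))))"
proof -
  have "Gamma (b * real n + 1) > 0" for n
    using assms by (intro Gamma_real_pos add_nonneg_pos) auto
  then have "norm (z ^ n / of_real (Gamma (b * real n + 1))) = \<bar>norm z\<bar> ^ n / Gamma (b * real n + 1)" for n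
    by (simp add: norm_divide norm_power less_imp_le)
  then show ?thesis
    using summable_Mittag_Leffler[OF assms, of "norm z"] by simp
qed

lemma mittag_leffler_sums:
  fixes z :: "'a::{real_normed_field, banach}"
  assumes "0 < b" "b \<le> 1"
  shows "(\<lambda>n. z ^ n / of_real (Gamma (b * real n + 1))) sums mittag_leffler b z"
  unfolding mittag_leffler_def
  by (rule summable_sums[OF summable_norm_cancel[OF mittag_leffler_summable_norm[OF assms]]])

lemma mittag_leffler_0:
  assumes "0 < b" "b \<le> 1"
  shows "mittag_leffler b (0::'a::{real_normed_field, banach}) = 1"
  unfolding mittag_leffler_def
  by (subst suminf_finite[of "{0}"]) auto

lemma isCont_mittag_leffler:
  fixes z :: "'a::{real_normed_field, banach}"
  assumes "0 < b" "b \<le> 1"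
  shows "isCont (mittag_leffler b) z"
proof -
  have "summable (\<lambda>n. 1 / of_real (Gamma (b * real n + 1)) * y ^ n)" for y :: 'a
    using mittag_leffler_sums[OF assms, of y] by (simp add: sums_iff)
  then have "isCont (\<lambda>x. \<Sum>n. 1 / of_real (Gamma (b * real n + 1)) * x ^ n) z"
    by (rule isCont_powser_converges_everywhere)
  then show ?thesis by (simp add: mittag_leffler_def[abs_def])
qed

section \<open>Taylor coefficients at -lam and the point masses\<close>

lemma funpow_diffs:
  fixes c :: "nat \<Rightarrow> 'a::field_char_0"
  shows "(diffs ^^ k) c j = fact (k + j) / fact j * c (k + j)"
proof (induction k arbitrary: j)
  case (Suc k)
  have "of_nat (Suc j) \<noteq> (0::'a)" by (rule of_nat_neq_0)
  moreover have "(diffs ^^ Suc k) c j = of_nat (Suc j) * (diffs ^^ k) c (Suc j)"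
    by (simp add: diffs_def)
  ultimately show ?case unfolding Suc by (simp del: of_nat_Suc)
qed auto

text \<open>Convergence everywhere is carried through the induction because the next termwise
  differentiation relies on it.\<close>

lemma funpow_deriv_powser:
  fixes c :: "nat \<Rightarrow> 'a::{real_normed_field, banach}"
  assumes "\<And>y. summable (\<lambda>n. c n * y ^ n)"
  shows "(\<forall>y. summable (\<lambda>n. (diffs ^^ k) c n * y ^ n)) \<and>
    (deriv ^^ k) (\<lambda>x. \<Sum>n. c n * x ^ n) = (\<lambda>x. \<Sum>n. (diffs ^^ k) c n * x ^ n)"
proof (induction k)
  case 0
  then show ?case using assms by simp
next
  case (Suc k)
  then have s: "summable (\<lambda>n. (diffs ^^ k) c n * y ^ n)" for y by blast
  have "summable (\<lambda>n. (diffs ^^ Suc k) c n * y ^ n)" for y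
    using termdiff_converges_all[OF s] by simp
  moreover have "(deriv ^^ Suc k) (\<lambda>x. \<Sum>n. c n * x ^ n) x = (\<Sum>n. (diffs ^^ Suc k) c n * x ^ n)" for x
    using Suc DERIV_imp_deriv[OF termdiffs_strong_converges_everywhere[OF s]] by simp
  ultimately show ?case by blast
qed

text \<open>The weight in \<open>frac_poisson\<close> before its conversion to
  \<open>ennreal\<close>, so that its sign can be a theorem.\<close>

definition frac_poisson_mass :: "real \<Rightarrow> real \<Rightarrow> nat \<Rightarrow> real" where
  "frac_poisson_mass lam b k = lam ^ k / fact k * (deriv ^^ k) (mittag_leffler b) (- lam)"

lemma frac_poisson_mass_sums:
  assumes "0 < b" "b \<le> 1"
  shows "(\<lambda>j. lam ^ k * (real ((k + j) choose j) * (- lam) ^ j / Gamma (b * real (k + j) + 1)))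
    sums frac_poisson_mass lam b k"
proof -
  define c where "c n = 1 / Gamma (b * real n + 1)" for n
  have s: "summable (\<lambda>n. c n * y ^ n)" for y :: real
    using mittag_leffler_sums[OF assms, of y] by (simp add: sums_iff c_def)
  have ml: "mittag_leffler b = (\<lambda>x::real. \<Sum>n. c n * x ^ n)"
    by (simp add: mittag_leffler_def[abs_def] c_def)
  have "(\<lambda>j. lam ^ k / fact k * ((diffs ^^ k) c j * (- lam) ^ j)) sums frac_poisson_mass lam b k"
    unfolding frac_poisson_mass_def ml conjunct2[OF funpow_deriv_powser[where c = c, OF s]]
    by (intro sums_mult summable_sums conjunct1[OF funpow_deriv_powser[where c = c, OF s], rule_format])
  moreover have "lam ^ k / fact k * ((diffs ^^ k) c j * (- lam) ^ j)
      = lam ^ k * (real ((k + j) choose j) * (- lam) ^ j / Gamma (b * real (k + j) + 1))" for j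
    by (simp add: funpow_diffs c_def binomial_fact)
  ultimately show ?thesis by simp
qed

lemma frac_poisson_mass_nonneg:
  assumes "lam > 0" "0 < b" "b \<le> 1"
  shows "frac_poisson_mass lam b k \<ge> 0"
proof -
  have "(\<lambda>j. lam ^ k * (real ((k + j) choose j) * (- lam) ^ j / Gamma (b * real (k + j) + 1)) / lam ^ k)
      sums (frac_poisson_mass lam b k / lam ^ k)"
    by (intro sums_divide frac_poisson_mass_sums assms)
  then have "frac_poisson_mass lam b k / lam ^ k
      = (\<Sum>j. real ((k + j) choose j) * (- lam) ^ j / Gamma (b * real (k + j) + 1))"
    using assms by (simp add: sums_iff)
  then have "frac_poisson_mass lam b k / lam ^ k \<ge> 0"
    using Prabhakar_series_nonneg[OF assms(2,3,1)] by simp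
  moreover have "lam ^ k > 0" using assms by simp
  ultimately show ?thesis by (auto simp: zero_le_divide_iff)
qed

text \<open>The double family \<open>g\<close> expands each (w - 1)^m binomially over the triangle k
  <= m. Summed by rows it gives the Mittag-Leffler function; summed by columns, with m = k + j, it
  gives the masses. The norms sum to the value at lam (|w| + 1), so the order may be exchanged. At w
  = 1 the result is total mass 1.\<close>

lemma frac_poisson_generating_function_sums:
  fixes w :: "'a::{real_normed_field, banach}"
  assumes lam: "lam > 0" and b: "0 < b" "b \<le> 1"
  shows "(\<lambda>k. of_real (frac_poisson_mass lam b k) * w ^ k)
    sums mittag_leffler b (of_real lam * (w - 1))"
proof -
  define r where "r n = 1 / Gamma (b * real n + 1)" for n
  have r_nonneg: "r n \<ge> 0" for n
    unfolding r_def using b by (intro divide_nonneg_nonneg less_imp_le[OF Gamma_real_pos] add_nonneg_pos) auto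
  define g where "g = (\<lambda>(m, k). of_real (r m) * of_real lam ^ m
      * (of_nat (m choose k) * w ^ k * (- 1) ^ (m - k)))"
  define T where "T = (SIGMA m:(UNIV::nat set). {..m})"
  have inner: "(\<Sum>k\<le>m. g (m, k)) = (of_real lam * (w - 1)) ^ m / of_real (Gamma (b * real m + 1))" for m
  proof -
    have "(w - 1) ^ m = (\<Sum>k\<le>m. of_nat (m choose k) * w ^ k * (- 1) ^ (m - k))"
      using binomial_ring[of w "- 1" m] by simp
    then show ?thesis
      by (simp add: g_def sum_distrib_left r_def power_mult_distrib sum_divide_distrib)
  qed
  have inner_norm: "(\<Sum>k\<le>m. norm (g (m, k))) = (lam * (norm w + 1)) ^ m / Gamma (b * real m + 1)" for m
  proof -
    have "(norm w + 1) ^ m = (\<Sum>k\<le>m. of_nat (m choose k) * norm w ^ k)"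
      using binomial_ring[of "norm w" 1 m] by simp
    moreover have "norm (g (m, k)) = r m * lam ^ m * (of_nat (m choose k) * norm w ^ k)" for k
      using lam r_nonneg[of m] by (simp add: g_def norm_mult norm_power)
    ultimately show ?thesis
      by (simp add: sum_distrib_left r_def power_mult_distrib sum_divide_distrib)
  qed
  have "(\<lambda>x. norm (g x)) summable_on T"
  proof -
    have "(\<lambda>m. norm ((lam * (norm w + 1)) ^ m / Gamma (b * real m + 1))) summable_on UNIV"
      using mittag_leffler_summable_norm[OF b, of "lam * (norm w + 1)"]
      by (subst summable_on_UNIV_nonneg_real_iff) auto
    then show ?thesis
      unfolding T_def Infinite_Sum.abs_summable_on_Sigma_iff by (simp add: inner_norm)
  qed
  then have gT: "g summable_on T" by (rule Infinite_Sum.abs_summable_summable)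
  then obtain S where S: "(g has_sum S) T" by (auto simp: summable_on_def)
  have "((\<lambda>m. (of_real lam * (w - 1)) ^ m / of_real (Gamma (b * real m + 1))) has_sum S) UNIV"
    by (rule has_sum_SigmaD[OF S[unfolded T_def]]) (auto simp: inner[symmetric])
  then have "S = mittag_leffler b (of_real lam * (w - 1))"
    by (rule sums_unique2[OF has_sum_imp_sums mittag_leffler_sums[OF b]])
  moreover have *: "((\<lambda>(k, j). g (k + j, k)) has_sum S) (UNIV \<times> UNIV)"
  proof -
    have "((\<lambda>(k, j). g (k + j, k)) has_sum S) (UNIV \<times> UNIV) \<longleftrightarrow> (g has_sum S) T"
      by (rule has_sum_reindex_bij_witness[of _ "\<lambda>(m, k). (k, m - k)" "\<lambda>(k, j). (k + j, k)"])
        (auto simp: T_def)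
    with S show ?thesis by blast
  qed
  have "((\<lambda>k. of_real (frac_poisson_mass lam b k) * w ^ k) has_sum S) UNIV"
  proof (rule has_sum_SigmaD[OF *])
    fix k
    have "(\<lambda>j. g (k + j, k)) summable_on UNIV"
    proof -
      have "g summable_on (\<lambda>j. (k + j, k)) ` UNIV"
        by (rule summable_on_subset_banach[OF gT]) (auto simp: T_def)
      then show ?thesis by (subst (asm) summable_on_reindex) (auto simp: inj_on_def o_def)
    qed
    then obtain s where s: "((\<lambda>j. g (k + j, k)) has_sum s) UNIV" by (auto simp: summable_on_def)
    have "(\<lambda>j. of_real (lam ^ k * (real ((k + j) choose j) * (- lam) ^ j / Gamma (b * real (k + j) + 1)))
        * w ^ k) sums (of_real (frac_poisson_mass lam b k) * w ^ k)"
      by (intro sums_mult2 sums_of_real frac_poisson_mass_sums b)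
    moreover have "of_real (lam ^ k * (real ((k + j) choose j) * (- lam) ^ j / Gamma (b * real (k + j) + 1)))
        * w ^ k = g (k + j, k)" for j
    proof -
      have "(k + j) choose j = (k + j) choose k" using binomial_symmetric[of j "k + j"] by simp
      then show ?thesis
        by (simp add: g_def r_def power_add power_minus[of lam] power_minus[of "of_real lam"] mult_ac)
    qed
    ultimately have "s = of_real (frac_poisson_mass lam b k) * w ^ k"
      using has_sum_imp_sums[OF s] sums_unique2 by simp
    with s show "((\<lambda>j. case (k, j) of (k, j) \<Rightarrow> g (k + j, k))
        has_sum of_real (frac_poisson_mass lam b k) * w ^ k) UNIV" by simp
  qed
  ultimately show ?thesis by (simp add: has_sum_imp_sums)
qed

lemma frac_poisson_mass_summable_power:
  fixes w :: real
  assumes "lam > 0" "0 < b" "b \<le> 1"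
  shows "summable (\<lambda>k. frac_poisson_mass lam b k * w ^ k)"
  using frac_poisson_generating_function_sums[OF assms, of w] by (simp add: sums_iff)

text \<open>Nonnegativity of the masses enters here: \<open>ennreal\<close> would replace a negative
  mass by 0.\<close>

lemma lebesgue_integral_frac_poisson:
  fixes f :: "real \<Rightarrow> complex"
  assumes p: "lam > 0" "0 < b" "b \<le> 1" and f: "f \<in> borel_measurable borel"
    and s: "summable (\<lambda>k. frac_poisson_mass lam b k * norm (f (real k)))"
  shows "lebesgue_integral (frac_poisson lam b) f
    = (\<Sum>k. of_real (frac_poisson_mass lam b k) * f (real k))"
proof -
  have fp: "frac_poisson lam b = distr (density (count_space UNIV)
      (\<lambda>k. ennreal (frac_poisson_mass lam b k))) borel (\<lambda>k::nat. real k)"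
    by (simp add: frac_poisson_def frac_poisson_mass_def)
  have "lebesgue_integral (frac_poisson lam b) f
      = integral\<^sup>L (count_space UNIV) (\<lambda>k. frac_poisson_mass lam b k *\<^sub>R f (real k))"
    unfolding fp
    by (subst integral_distr) (use f frac_poisson_mass_nonneg[OF p] in \<open>auto simp: integral_density\<close>)
  also have "\<dots> = (\<Sum>k. frac_poisson_mass lam b k *\<^sub>R f (real k))"
    using s frac_poisson_mass_nonneg[OF p]
    by (intro integral_count_space_nat) (simp add: integrable_count_space_nat_iff)
  finally show ?thesis by (simp add: scaleR_conv_of_real)
qed

section \<open>Dual Appell functionals\<close>

text \<open>Exponentials are eigenfunctions of the difference operator with eigenvalue exp z - 1;
  hence the S-transform is a power series in exp z - 1.\<close>

lemma forward_diff_exp: "forward_diff (\<lambda>x. c * exp (z * of_real x)) = (\<lambda>x. (c * (exp z - 1)) * exp (z * of_real x))"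
  by (simp add: forward_diff_def fun_eq_iff distrib_left exp_add algebra_simps)

lemma funpow_forward_diff_exp:
  "(forward_diff ^^ n) (\<lambda>x. c * exp (z * of_real x)) = (\<lambda>x. (exp z - 1) ^ n * c * exp (z * of_real x))"
proof (induction n)
  case (Suc n)
  then show ?case
    using forward_diff_exp[of "(exp z - 1) ^ n * c" z] by (simp add: mult_ac)
qed simp

lemma forward_diff_zero: "forward_diff (\<lambda>x. 0) = (\<lambda>x. 0)"
  by (simp add: forward_diff_def)

lemma funpow_forward_diff_zero: "(forward_diff ^^ n) (\<lambda>x. 0) = (\<lambda>x. 0)"
  by (induction n) (simp_all add: forward_diff_zero)

lemma forward_diff_poly:
  "forward_diff (\<lambda>x. poly f (of_real x)) = (\<lambda>x. poly (pcompose f [:1, 1:] - f) (of_real x))"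
  by (simp add: forward_diff_def fun_eq_iff poly_pcompose add.commute)

text \<open>A shift preserves degree and leading coefficient, so the leading terms cancel. The first
  alternative covers constants, for which the zero difference also has degree 0.\<close>

lemma pcompose_shift_diff:
  fixes f :: "complex poly"
  shows "pcompose f [:1, 1:] - f = 0 \<or> degree (pcompose f [:1, 1:] - f) < degree f"
proof (rule eq_zero_or_degree_less)
  have deg: "degree (pcompose f [:1, 1:]) = degree f" by (simp add: degree_pcompose)
  then show "degree (pcompose f [:1, 1:] - f) \<le> degree f"
    by (intro degree_diff_le) auto
  have "lead_coeff (pcompose f [:1, 1:]) = lead_coeff f" by (simp add: lead_coeff_comp)
  then show "coeff (pcompose f [:1, 1:] - f) (degree f) = 0" using deg by simp
qed

lemma funpow_forward_diff_poly_eq_0: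
  "degree f < n \<Longrightarrow> (forward_diff ^^ n) (\<lambda>x. poly f (of_real x)) = (\<lambda>x. 0)"
proof (induction n arbitrary: f)
  case (Suc n)
  have *: "(forward_diff ^^ Suc n) (\<lambda>x. poly f (of_real x))
      = (forward_diff ^^ n) (\<lambda>x. poly (pcompose f [:1, 1:] - f) (of_real x))"
    by (simp only: funpow_Suc_right o_apply forward_diff_poly)
  show ?case
  proof (cases "pcompose f [:1, 1:] - f = 0")
    case True
    then show ?thesis unfolding * by (simp add: funpow_forward_diff_zero)
  next
    case False
    then have "degree (pcompose f [:1, 1:] - f) < n"
      using pcompose_shift_diff[of f] Suc.prems by linarith
    then show ?thesis unfolding * by (rule Suc.IH)
  qed
qed simp

text \<open>The Newton basis. Its pairing with the dual Appell functionals is triangular with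
  diagonal n!, which suffices to recover coefficients without the Appell polynomials.\<close>

definition falling_factorial_poly :: "nat \<Rightarrow> complex poly" where
  "falling_factorial_poly n = (\<Prod>i<n. [:- of_nat i, 1:])"

lemma degree_falling_factorial_poly: "degree (falling_factorial_poly n) = n"
  unfolding falling_factorial_poly_def by (subst degree_prod_sum_eq) auto

lemma poly_falling_factorial_poly: "poly (falling_factorial_poly n) x = (\<Prod>i<n. x - of_nat i)"
  by (simp add: falling_factorial_poly_def poly_prod)

text \<open>Both values share the product \<open>P\<close>; the remaining factors y + 1 and y - n
  differ by n + 1.\<close>

lemma forward_diff_falling_factorial:
  "forward_diff (\<lambda>x. c * poly (falling_factorial_poly (Suc n)) (of_real x))
    = (\<lambda>x. (c * of_nat (Suc n)) * poly (falling_factorial_poly n) (of_real x))"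
proof
  fix x :: real
  define y :: complex where "y = of_real x"
  define P where "P = (\<Prod>i<n. y - of_nat i)"
  have "(\<Prod>i<Suc n. y + 1 - of_nat i) = (y + 1) * P"
    unfolding P_def by (subst prod.lessThan_Suc_shift) simp
  then have "poly (falling_factorial_poly (Suc n)) (of_real (x + 1)) = (y + 1) * P"
    by (simp only: poly_falling_factorial_poly of_real_add of_real_1 y_def)
  moreover have "poly (falling_factorial_poly (Suc n)) (of_real x) = (y - of_nat n) * P"
    by (simp add: poly_falling_factorial_poly P_def y_def)
  moreover have "poly (falling_factorial_poly n) (of_real x) = P"
    by (simp add: poly_falling_factorial_poly P_def y_def)
  ultimately show "forward_diff (\<lambda>x. c * poly (falling_factorial_poly (Suc n)) (of_real x)) x
      = (c * of_nat (Suc n)) * poly (falling_factorial_poly n) (of_real x)"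
    by (simp only: forward_diff_def) (simp add: algebra_simps)
qed

lemma funpow_forward_diff_falling_factorial:
  "(forward_diff ^^ n) (\<lambda>x. c * poly (falling_factorial_poly n) (of_real x)) = (\<lambda>x. c * fact n)"
proof (induction n arbitrary: c)
  case 0
  then show ?case by (simp add: falling_factorial_poly_def)
next
  case (Suc n)
  show ?case
    unfolding funpow_Suc_right o_apply forward_diff_falling_factorial Suc
    by (simp add: mult_ac)
qed

lemma isCont_tendsto_nhds: "isCont f a \<Longrightarrow> filterlim f (nhds (f a)) (nhds a)"
  by (simp only: isCont_def tendsto_at_iff_tendsto_nhds)

section \<open>Coefficients and S-transforms of generalised functions\<close>

locale frac_poisson_params =
  fixes lam \<beta> :: real
  assumes params: "lam > 0" "0 < \<beta>" "\<beta> \<le> 1"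
begin

text \<open>The n-th difference contributes the n-th power of the eigenvalue, and the integral of
  exp (z x) is the generating function at exp z, which cancels the normalising denominator.\<close>

lemma dual_appell_exp:
  assumes "mittag_leffler \<beta> (of_real lam * (exp z - 1)) \<noteq> (0::complex)"
  shows "dual_appell lam \<beta> n (\<lambda>x. exp (z * of_real x) / mittag_leffler \<beta> (of_real lam * (exp z - 1)))
    = (exp z - 1) ^ n"
proof -
  define E where "E = mittag_leffler \<beta> (of_real lam * (exp z - 1))"
  define d where "d = (exp z - 1) ^ n * (1 / E)"
  have "(forward_diff ^^ n) (\<lambda>x. exp (z * of_real x) / E) = (\<lambda>x. d * exp (z * of_real x))"
    using funpow_forward_diff_exp[of n "1 / E" z] by (simp add: d_def)
  then have "dual_appell lam \<beta> n (\<lambda>x. exp (z * of_real x) / E)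
      = lebesgue_integral (frac_poisson lam \<beta>) (\<lambda>x. d * exp (z * of_real x))"
    by (simp add: dual_appell_def)
  also have "\<dots> = (\<Sum>k. of_real (frac_poisson_mass lam \<beta> k) * (d * exp (z * of_real (real k))))"
  proof (rule lebesgue_integral_frac_poisson[OF params])
    show "(\<lambda>x. d * exp (z * complex_of_real x)) \<in> borel_measurable borel"
      by (intro borel_measurable_continuous_onI continuous_intros)
    have "summable (\<lambda>k. norm d * (frac_poisson_mass lam \<beta> k * norm (exp z) ^ k))"
      by (intro summable_mult frac_poisson_mass_summable_power params)
    then show "summable (\<lambda>k. frac_poisson_mass lam \<beta> k * norm (d * exp (z * of_real (real k))))"
      by (simp add: norm_mult exp_of_nat2_mult norm_power mult_ac)
  qed
  also have "\<dots> = d * E"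
  proof -
    have "(\<lambda>k. d * (of_real (frac_poisson_mass lam \<beta> k) * exp z ^ k)) sums (d * E)"
      unfolding E_def by (intro sums_mult frac_poisson_generating_function_sums params)
    moreover have "of_real (frac_poisson_mass lam \<beta> k) * (d * exp (z * of_real (real k)))
        = d * (of_real (frac_poisson_mass lam \<beta> k) * exp z ^ k)" for k
      by (simp add: exp_of_nat2_mult)
    ultimately have "(\<lambda>k. of_real (frac_poisson_mass lam \<beta> k) * (d * exp (z * of_real (real k)))) sums (d * E)"
      by (simp only:)
    then show ?thesis by (rule sums_unique[symmetric])
  qed
  finally show ?thesis using assms by (simp add: E_def d_def)
qed

lemma dual_appell_poly_eq_0:
  "degree f < n \<Longrightarrow> dual_appell lam \<beta> n (\<lambda>x. poly f (of_real x)) = 0"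
  by (simp add: dual_appell_def funpow_forward_diff_poly_eq_0)

lemma dual_appell_falling_factorial:
  "dual_appell lam \<beta> n (\<lambda>x. poly (falling_factorial_poly n) (of_real x)) = fact n"
proof -
  have "dual_appell lam \<beta> n (\<lambda>x. poly (falling_factorial_poly n) (of_real x))
      = lebesgue_integral (frac_poisson lam \<beta>) (\<lambda>x. fact n)"
    using funpow_forward_diff_falling_factorial[of n 1] by (simp add: dual_appell_def)
  also have "\<dots> = (\<Sum>k. of_real (frac_poisson_mass lam \<beta> k) * fact n)"
    using frac_poisson_mass_summable_power[OF params, of 1]
    by (intro lebesgue_integral_frac_poisson[OF params] summable_mult2) auto
  also have "\<dots> = fact n"
    using sums_mult2[OF frac_poisson_generating_function_sums[OF params, of "1::complex"], of "fact n"]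
    by (simp add: sums_iff mittag_leffler_0 params)
  finally show ?thesis .
qed

lemma dual_series_eq_sum:
  assumes "degree f \<le> N"
  shows "dual_series lam \<beta> a f = (\<Sum>n\<le>N. a n * dual_appell lam \<beta> n (\<lambda>x. poly f (of_real x)))"
  unfolding dual_series_def
  by (rule suminf_finite) (use assms dual_appell_poly_eq_0 in auto)

lemma dual_series_linear:
  "dual_series lam \<beta> (\<lambda>n. x * a n + y * b n)
    = (\<lambda>f. x * dual_series lam \<beta> a f + y * dual_series lam \<beta> b f)"
  by (simp add: fun_eq_iff dual_series_eq_sum[OF order_refl] distrib_right sum.distrib
      sum_distrib_left mult.assoc)

text \<open>Tested on the n-th falling factorial, the series stops at index n and a n has the factor
  n!, so strong induction recovers the coefficients. This makes the description in
  \<open>dual_coeff\<close> meaningful.\<close>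

lemma dual_series_inject: "dual_series lam \<beta> a = dual_series lam \<beta> b \<longleftrightarrow> a = b"
proof
  assume eq: "dual_series lam \<beta> a = dual_series lam \<beta> b"
  have "a n = b n" for n
  proof (induction n rule: less_induct)
    case (less n)
    define D where "D m = dual_appell lam \<beta> m (\<lambda>x. poly (falling_factorial_poly n) (of_real x))" for m
    have "dual_series lam \<beta> c (falling_factorial_poly n) = (\<Sum>m<n. c m * D m) + c n * fact n" for c
      by (subst dual_series_eq_sum[of _ n])
        (simp_all add: degree_falling_factorial_poly D_def lessThan_Suc_atMost[symmetric]
          dual_appell_falling_factorial)
    from this[of a] this[of b] eq
    have "(\<Sum>m<n. a m * D m) + a n * fact n = (\<Sum>m<n. b m * D m) + b n * fact n" by simp
    moreover have "(\<Sum>m<n. a m * D m) = (\<Sum>m<n. b m * D m)" using less by simp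
    ultimately show ?case by simp
  qed
  then show "a = b" by blast
qed simp

lemma dual_coeff_dual_series: "dual_coeff lam \<beta> (dual_series lam \<beta> a) = a"
  unfolding dual_coeff_def by (rule the_equality) (simp_all add: dual_series_inject eq_commute)

lemma dual_series_in_H_neg:
  "dual_series lam \<beta> a \<in> H_neg lam \<beta> q \<longleftrightarrow> summable (\<lambda>n. (1 / 2) ^ (n * q) * (cmod (a n))\<^sup>2)"
  by (auto simp: H_neg_def dual_series_inject)

lemma H_norm_dual_series:
  "H_norm lam \<beta> q (dual_series lam \<beta> a) = sqrt (\<Sum>n. (1 / 2) ^ (n * q) * (cmod (a n))\<^sup>2)"
  by (simp add: H_norm_def dual_coeff_dual_series)

lemma S_transform_dual_series:
  assumes "mittag_leffler \<beta> (of_real lam * (exp z - 1)) \<noteq> (0::complex)"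
  shows "S_transform lam \<beta> (dual_series lam \<beta> a) z = (\<Sum>n. a n * (exp z - 1) ^ n)"
  by (simp add: S_transform_def dual_coeff_dual_series dual_appell_exp[OF assms])

lemma eventually_mittag_leffler_nonzero:
  "\<forall>\<^sub>F z in nhds 0. mittag_leffler \<beta> (of_real lam * (exp z - 1)) \<noteq> (0::complex)"
proof -
  have "isCont (\<lambda>z::complex. of_real lam * (exp z - 1)) 0"
    by (intro continuous_intros)
  then have "isCont (\<lambda>z::complex. mittag_leffler \<beta> (of_real lam * (exp z - 1))) 0"
    by (rule isCont_o2) (rule isCont_mittag_leffler[OF params(2,3)])
  then have "((\<lambda>z::complex. mittag_leffler \<beta> (of_real lam * (exp z - 1))) \<longlongrightarrow> 1) (nhds 0)"
    using isCont_tendsto_nhds by (fastforce simp: mittag_leffler_0 params)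
  then show ?thesis by (rule tendsto_imp_eventually_ne) simp
qed

end

section \<open>Weighted square-summable sequences and their Cauchy products\<close>

lemma summable_norm_powser_weighted:
  fixes a :: "nat \<Rightarrow> complex"
  assumes a: "summable (\<lambda>n. (1 / 2) ^ (n * q) * (cmod (a n))\<^sup>2)" and w: "norm w < (1 / 2) ^ q"
  shows "summable (\<lambda>n. norm (a n * w ^ n))"
proof -
  \<comment> \<open>x^n is the square of |w|^n divided by the weight; half of x^n plus the weighted
    square of a n dominates |a n w^n| by 2uv <= u^2 + v^2.\<close>
  define x where "x = 2 ^ q * (norm w)\<^sup>2"
  have "x < 1"
  proof -
    have "2 ^ q * norm w \<le> 2 ^ q * (1 / 2) ^ q" using w by (intro mult_left_mono) auto
    also have "\<dots> = 1" by (simp add: power_divide)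
    finally have "(2 ^ q * norm w) * norm w \<le> 1 * norm w" by (rule mult_right_mono) simp
    also have "\<dots> < 1" using w power_le_one[of "1/2::real" q] by simp
    finally show ?thesis by (simp add: x_def power2_eq_square mult.assoc)
  qed
  then have "summable (\<lambda>n. x ^ n)" by (intro summable_geometric) (simp add: x_def abs_mult)
  with a have "summable (\<lambda>n. ((1 / 2) ^ (n * q) * (cmod (a n))\<^sup>2 + x ^ n) / 2)"
    by (intro summable_divide summable_add)
  then show ?thesis
  proof (rule summable_comparison_test')
    fix n
    define u where "u = sqrt ((1 / 2) ^ (n * q))"
    have u: "u > 0" "u\<^sup>2 = (1 / 2) ^ (n * q)" by (simp_all add: u_def)
    have "x ^ n = (norm w ^ n / u)\<^sup>2"
      by (simp add: x_def power_divide u power_mult_distrib power_mult[symmetric] mult.commute)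
    moreover have "2 * (u * cmod (a n)) * (norm w ^ n / u) \<le> (u * cmod (a n))\<^sup>2 + (norm w ^ n / u)\<^sup>2"
      by (rule sum_squares_bound)
    ultimately show "norm (norm (a n * w ^ n)) \<le> ((1 / 2) ^ (n * q) * (cmod (a n))\<^sup>2 + x ^ n) / 2"
      using u by (simp add: norm_mult norm_power power_mult_distrib)
  qed
qed

definition convolution :: "(nat \<Rightarrow> complex) \<Rightarrow> (nat \<Rightarrow> complex) \<Rightarrow> nat \<Rightarrow> complex" where
  "convolution a b n = (\<Sum>k\<le>n. a k * b (n - k))"

text \<open>For k <= n, 2^(-n(p+q)) <= 2^(-kq) 2^(-(n-k)p), so up to the factor n + 1 from
  Cauchy-Schwarz the n-th weighted square is at most the n-th term of the Cauchy product of the two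
  norm series. The extra 1 in the index pays for that factor.\<close>

lemma weighted_convolution_bound:
  assumes a: "summable (\<lambda>n. (1 / 2) ^ (n * q) * (cmod (a n))\<^sup>2)" (is "summable ?A")
    and b: "summable (\<lambda>n. (1 / 2) ^ (n * p) * (cmod (b n))\<^sup>2)" (is "summable ?B")
  defines "C \<equiv> \<lambda>n. (1 / 2) ^ (n * (p + q + 1)) * (cmod (convolution a b n))\<^sup>2"
  shows "summable C" "(\<Sum>n. C n) \<le> (\<Sum>n. ?A n) * (\<Sum>n. ?B n)"
proof -
  have sums: "(\<lambda>n. \<Sum>k\<le>n. ?A k * ?B (n - k)) sums ((\<Sum>n. ?A n) * (\<Sum>n. ?B n))"
    by (rule Cauchy_product_sums) (use a b in simp_all)
  have le: "C n \<le> (\<Sum>k\<le>n. ?A k * ?B (n - k))" for n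
  proof -
    \<comment> \<open>What remains of the weight after the factor 2^n has been cancelled.\<close>
    define w :: real where "w = (1 / 2) ^ (n * p) * (1 / 2) ^ (n * q)"
    have "cmod (convolution a b n) \<le> (\<Sum>k\<le>n. cmod (a k) * cmod (b (n - k)))"
      unfolding convolution_def by (rule order_trans[OF norm_sum]) (simp add: norm_mult)
    then have "(cmod (convolution a b n))\<^sup>2 \<le> (\<Sum>k\<le>n. cmod (a k) * cmod (b (n - k)))\<^sup>2"
      by (intro power_mono) auto
    also have "\<dots> \<le> (\<Sum>k\<le>n. (cmod (a k) * cmod (b (n - k)))\<^sup>2) * real (card {..n})"
      by (rule sum_squared_le_sum_of_squares)
    also have "\<dots> \<le> (\<Sum>k\<le>n. (cmod (a k) * cmod (b (n - k)))\<^sup>2) * 2 ^ n"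
    proof (intro mult_left_mono sum_nonneg)
      have "Suc n \<le> 2 ^ n" by (rule Suc_leI) (rule less_exp)
      then have "real (Suc n) \<le> real (2 ^ n)" by (rule of_nat_mono)
      then show "real (card {..n}) \<le> 2 ^ n" by simp
    qed auto
    finally have "C n \<le> (1 / 2) ^ (n * (p + q + 1))
        * ((\<Sum>k\<le>n. (cmod (a k) * cmod (b (n - k)))\<^sup>2) * 2 ^ n)"
      unfolding C_def by (rule mult_left_mono) simp
    also have "\<dots> = (\<Sum>k\<le>n. w * (cmod (a k) * cmod (b (n - k)))\<^sup>2)"
      by (simp add: w_def distrib_left power_add power_divide sum_divide_distrib)
    also have "\<dots> \<le> (\<Sum>k\<le>n. ?A k * ?B (n - k))"
    proof (rule sum_mono)
      fix k assume k: "k \<in> {..n}"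
      have "(1 / 2 :: real) ^ (n * p) \<le> (1 / 2) ^ ((n - k) * p)"
        by (intro power_decreasing) auto
      moreover have "(1 / 2 :: real) ^ (n * q) \<le> (1 / 2) ^ (k * q)"
        using k by (intro power_decreasing) auto
      ultimately have "w \<le> (1 / 2) ^ ((n - k) * p) * (1 / 2) ^ (k * q)"
        unfolding w_def by (intro mult_mono) auto
      then have "w * (cmod (a k) * cmod (b (n - k)))\<^sup>2
          \<le> (1 / 2) ^ ((n - k) * p) * (1 / 2) ^ (k * q) * (cmod (a k) * cmod (b (n - k)))\<^sup>2"
        by (rule mult_right_mono) simp
      then show "w * (cmod (a k) * cmod (b (n - k)))\<^sup>2 \<le> ?A k * ?B (n - k)"
        by (simp add: power_mult_distrib mult_ac)
    qed
    finally show ?thesis .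
  qed
  show "summable C"
    by (rule summable_comparison_test'[OF sums_summable[OF sums]]) (use le in \<open>auto simp: C_def\<close>)
  then show "(\<Sum>n. C n) \<le> (\<Sum>n. ?A n) * (\<Sum>n. ?B n)"
    using suminf_le[OF le _ sums_summable[OF sums]] sums_unique[OF sums] by simp
qed

section \<open>The Wick product\<close>

text \<open>A power series with a nonzero coefficient and value 0 at the origin has an isolated zero
  there.\<close>

lemma powser_eq_0_imp_coeff_eq_0:
  fixes e :: "nat \<Rightarrow> complex"
  assumes r: "r > 0" and s: "\<And>w. norm w < r \<Longrightarrow> summable (\<lambda>n. e n * w ^ n)"
    and zero: "\<forall>\<^sub>F w in nhds 0. (\<Sum>n. e n * w ^ n) = 0"
  shows "e n = 0"
proof (rule ccontr)
  assume n: "e n \<noteq> 0"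
  obtain \<delta> where \<delta>: "\<delta> > 0" "\<And>w. norm w < \<delta> \<Longrightarrow> (\<Sum>n. e n * w ^ n) = 0"
    using zero by (auto simp: eventually_nhds_metric)
  have "(\<Sum>n. e n * 0 ^ n) = e 0" by (rule powser_zero)
  then have "e 0 = 0" using \<delta>(2)[of 0] \<delta>(1) by simp
  with n have "n > 0" by (cases n) auto
  obtain t where t: "t > 0" "\<And>w. w \<in> cball 0 t - {0} \<Longrightarrow> (\<Sum>n. e n * w ^ n) \<noteq> 0"
    by (rule powser_0_nonzero[of r 0 e "\<lambda>w. \<Sum>n. e n * w ^ n" n])
      (use r s n \<open>n > 0\<close> \<open>e 0 = 0\<close> in \<open>auto simp: summable_sums powser_zero\<close>)
  define w :: complex where "w = of_real (min t (\<delta> / 2))"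
  have "norm w = min t (\<delta> / 2)" "w \<noteq> 0" using t \<delta> by (auto simp: w_def)
  then have "w \<in> cball 0 t - {0}" "norm w < \<delta>" using t \<delta> by auto
  then show False using t(2) \<delta>(2) by blast
qed

lemma eventually_exp_minus_1:
  assumes "\<forall>\<^sub>F w in nhds (0::complex). P w"
  shows "\<forall>\<^sub>F z in nhds 0. P (exp z - 1)"
proof -
  have "isCont (\<lambda>z::complex. exp z - 1) 0" by (intro continuous_intros)
  then have "filterlim (\<lambda>z::complex. exp z - 1) (nhds 0) (nhds 0)"
    using isCont_tendsto_nhds by fastforce
  then show ?thesis using assms by (rule eventually_compose_filterlim[rotated])
qed

lemma eventually_norm_less: "r > 0 \<Longrightarrow> \<forall>\<^sub>F w in nhds (0::complex). norm w < r"
  unfolding eventually_nhds_metric by auto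

text \<open>Substitute z = Ln (1 + w), which is continuous at w = 0; |w| < 1 keeps 1 + w nonzero, so
  that exp inverts Ln. Identities of S-transforms thus become identities of power series in
  w.\<close>

lemma eventually_from_exp_minus_1:
  assumes "\<forall>\<^sub>F z in nhds (0::complex). P (exp z - 1)"
  shows "\<forall>\<^sub>F w in nhds 0. P w"
proof -
  have "isCont (\<lambda>w::complex. Ln (1 + w)) 0"
    by (intro continuous_intros) auto
  then have "filterlim (\<lambda>w::complex. Ln (1 + w)) (nhds 0) (nhds 0)"
    using isCont_tendsto_nhds by fastforce
  with assms have "\<forall>\<^sub>F w in nhds (0::complex). P (exp (Ln (1 + w)) - 1)"
    by (rule eventually_compose_filterlim)
  moreover have "\<forall>\<^sub>F w in nhds (0::complex). norm w < 1"
    by (rule eventually_norm_less) simp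
  ultimately show ?thesis
  proof eventually_elim
    case (elim w)
    then have "1 + w \<noteq> 0" by (metis add_eq_0_iff norm_minus_cancel norm_one less_irrefl)
    with elim show ?case by simp
  qed
qed

text \<open>The defining condition is symmetric in the factors. This later transfers linearity from
  the left factor to the right one.\<close>

lemma wick_commute: "wick lam \<beta> \<Phi> \<Psi> = wick lam \<beta> \<Psi> \<Phi>"
  by (simp add: wick_def mult.commute)

context frac_poisson_params
begin

lemma eventually_S_transform_dual_series:
  "\<forall>\<^sub>F z in nhds 0. S_transform lam \<beta> (dual_series lam \<beta> a) z = (\<Sum>n. a n * (exp z - 1) ^ n)"
  using eventually_mittag_leffler_nonzero by eventually_elim (rule S_transform_dual_series)

lemma dual_series_eq_if_S_transform_eq:
  assumes a: "summable (\<lambda>n. (1 / 2) ^ (n * q) * (cmod (a n))\<^sup>2)"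
    and b: "summable (\<lambda>n. (1 / 2) ^ (n * p) * (cmod (b n))\<^sup>2)"
    and eq: "\<forall>\<^sub>F z in nhds 0. S_transform lam \<beta> (dual_series lam \<beta> a) z
      = S_transform lam \<beta> (dual_series lam \<beta> b) z"
  shows "a = b"
proof
  fix n
  define r :: real where "r = min ((1 / 2) ^ q) ((1 / 2) ^ p)"
  have r: "r > 0" by (simp add: r_def)
  have sa: "summable (\<lambda>n. a n * w ^ n)" and sb: "summable (\<lambda>n. b n * w ^ n)" if "norm w < r" for w
    using that summable_norm_powser_weighted[OF a, of w] summable_norm_powser_weighted[OF b, of w]
    by (auto simp: r_def intro: summable_norm_cancel)
  have "\<forall>\<^sub>F z in nhds 0. (\<Sum>n. a n * (exp z - 1) ^ n) = (\<Sum>n. b n * (exp z - 1) ^ n)"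
    using eq eventually_S_transform_dual_series[of a] eventually_S_transform_dual_series[of b]
    by eventually_elim simp
  then have "\<forall>\<^sub>F w in nhds 0. (\<Sum>n. a n * w ^ n) = (\<Sum>n. b n * w ^ n)"
    by (rule eventually_from_exp_minus_1)
  with eventually_norm_less[OF r] have "\<forall>\<^sub>F w in nhds 0. (\<Sum>n. (a n - b n) * w ^ n) = 0"
    by eventually_elim (simp add: left_diff_distrib suminf_diff[symmetric] sa sb)
  then have "a n - b n = 0"
    by (intro powser_eq_0_imp_coeff_eq_0[OF r])
      (auto simp: left_diff_distrib intro: summable_diff sa sb)
  then show "a n = b n" by simp
qed

text \<open>The Cauchy product of the two power series in exp z - 1 gives existence in the
  description \<open>wick\<close>; injectivity of the S-transform gives uniqueness.\<close>

lemma wick_dual_series: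
  assumes a: "summable (\<lambda>n. (1 / 2) ^ (n * q) * (cmod (a n))\<^sup>2)"
    and b: "summable (\<lambda>n. (1 / 2) ^ (n * p) * (cmod (b n))\<^sup>2)"
  shows "wick lam \<beta> (dual_series lam \<beta> a) (dual_series lam \<beta> b) = dual_series lam \<beta> (convolution a b)"
proof -
  let ?S = "dual_series lam \<beta>"
  define r :: real where "r = min ((1 / 2) ^ q) ((1 / 2) ^ p)"
  have r: "r > 0" by (simp add: r_def)
  note c = weighted_convolution_bound(1)[OF a b]
  have "\<forall>\<^sub>F z in nhds 0. (\<Sum>n. convolution a b n * (exp z - 1) ^ n)
      = (\<Sum>n. a n * (exp z - 1) ^ n) * (\<Sum>n. b n * (exp z - 1) ^ n)"
    using eventually_exp_minus_1[OF eventually_norm_less[OF r]]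
  proof eventually_elim
    case (elim z)
    define w where "w = exp z - 1"
    have "(\<Sum>n. a n * w ^ n) * (\<Sum>n. b n * w ^ n)
        = (\<Sum>n. \<Sum>k\<le>n. (a k * w ^ k) * (b (n - k) * w ^ (n - k)))"
      using elim summable_norm_powser_weighted[OF a, of w] summable_norm_powser_weighted[OF b, of w]
      by (intro Cauchy_product) (auto simp: r_def w_def)
    also have "(\<lambda>n. \<Sum>k\<le>n. (a k * w ^ k) * (b (n - k) * w ^ (n - k))) = (\<lambda>n. convolution a b n * w ^ n)"
    proof
      fix n
      have "(a k * w ^ k) * (b (n - k) * w ^ (n - k)) = (a k * b (n - k)) * w ^ n" if "k \<in> {..n}" for k
        using power_add[of w k "n - k"] that by simp
      then show "(\<Sum>k\<le>n. (a k * w ^ k) * (b (n - k) * w ^ (n - k))) = convolution a b n * w ^ n"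
        unfolding convolution_def sum_distrib_right by (rule sum.cong[OF refl])
    qed
    finally show ?case by (simp add: w_def)
  qed
  then have S_mult: "\<forall>\<^sub>F z in nhds 0. S_transform lam \<beta> (?S (convolution a b)) z
      = S_transform lam \<beta> (?S a) z * S_transform lam \<beta> (?S b) z"
    using eventually_S_transform_dual_series[of a] eventually_S_transform_dual_series[of b]
      eventually_S_transform_dual_series[of "convolution a b"]
    by eventually_elim simp
  show ?thesis
    unfolding wick_def
  proof (rule the_equality)
    have "?S (convolution a b) \<in> N_neg lam \<beta>"
      using c unfolding N_neg_def dual_series_in_H_neg[symmetric] by blast
    with S_mult show "?S (convolution a b) \<in> N_neg lam \<beta> \<and>
        (\<forall>\<^sub>F z in nhds 0. S_transform lam \<beta> (?S (convolution a b)) z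
           = S_transform lam \<beta> (?S a) z * S_transform lam \<beta> (?S b) z)" by blast
  next
    fix \<Theta>
    assume \<Theta>: "\<Theta> \<in> N_neg lam \<beta> \<and> (\<forall>\<^sub>F z in nhds 0. S_transform lam \<beta> \<Theta> z
           = S_transform lam \<beta> (?S a) z * S_transform lam \<beta> (?S b) z)"
    \<comment> \<open>A competitor may lie in a space of any index \<open>s\<close>, hence the two
      separate indices in the uniqueness lemma.\<close>
    then obtain d s where d: "\<Theta> = ?S d" "summable (\<lambda>n. (1 / 2) ^ (n * s) * (cmod (d n))\<^sup>2)"
      unfolding N_neg_def H_neg_def by blast
    have "\<forall>\<^sub>F z in nhds 0. S_transform lam \<beta> (?S d) z = S_transform lam \<beta> (?S (convolution a b)) z"
      using \<Theta>[THEN conjunct2] S_mult unfolding d(1) by eventually_elim simp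
    then have "d = convolution a b"
      by (rule dual_series_eq_if_S_transform_eq[OF d(2) c])
    then show "\<Theta> = ?S (convolution a b)" using d(1) by simp
  qed
qed

section \<open>Norm estimate, inclusions of the spaces and bilinearity\<close>

lemma H_negE:
  assumes "\<Phi> \<in> H_neg lam \<beta> q"
  obtains a where "\<Phi> = dual_series lam \<beta> a" "summable (\<lambda>n. (1 / 2) ^ (n * q) * (cmod (a n))\<^sup>2)"
  using assms unfolding H_neg_def by blast

lemma wick_H_neg:
  assumes "\<Phi> \<in> H_neg lam \<beta> q" "\<Psi> \<in> H_neg lam \<beta> p"
  shows "wick lam \<beta> \<Phi> \<Psi> \<in> H_neg lam \<beta> (p + q + 1)"
    and "H_norm lam \<beta> (p + q + 1) (wick lam \<beta> \<Phi> \<Psi>) \<le> H_norm lam \<beta> q \<Phi> * H_norm lam \<beta> p \<Psi>"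
proof -
  from assms(1) obtain a where a: "\<Phi> = dual_series lam \<beta> a"
    "summable (\<lambda>n. (1 / 2) ^ (n * q) * (cmod (a n))\<^sup>2)" by (rule H_negE)
  from assms(2) obtain b where b: "\<Psi> = dual_series lam \<beta> b"
    "summable (\<lambda>n. (1 / 2) ^ (n * p) * (cmod (b n))\<^sup>2)" by (rule H_negE)
  have w: "wick lam \<beta> \<Phi> \<Psi> = dual_series lam \<beta> (convolution a b)"
    unfolding a(1) b(1) by (rule wick_dual_series[OF a(2) b(2)])
  show "wick lam \<beta> \<Phi> \<Psi> \<in> H_neg lam \<beta> (p + q + 1)"
    unfolding w dual_series_in_H_neg by (rule weighted_convolution_bound(1)[OF a(2) b(2)])
  show "H_norm lam \<beta> (p + q + 1) (wick lam \<beta> \<Phi> \<Psi>) \<le> H_norm lam \<beta> q \<Phi> * H_norm lam \<beta> p \<Psi>"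
    unfolding w unfolding a(1) b(1) H_norm_dual_series real_sqrt_mult[symmetric]
    by (intro real_sqrt_le_mono weighted_convolution_bound(2)[OF a(2) b(2)])
qed

lemma H_neg_mono:
  assumes "\<Phi> \<in> H_neg lam \<beta> q" "q \<le> r"
  shows "\<Phi> \<in> H_neg lam \<beta> r" and "H_norm lam \<beta> r \<Phi> \<le> H_norm lam \<beta> q \<Phi>"
proof -
  from assms(1) obtain a where a: "\<Phi> = dual_series lam \<beta> a"
    "summable (\<lambda>n. (1 / 2) ^ (n * q) * (cmod (a n))\<^sup>2)" by (rule H_negE)
  have le: "(1 / 2) ^ (n * r) * (cmod (a n))\<^sup>2 \<le> (1 / 2) ^ (n * q) * (cmod (a n))\<^sup>2" for n
    using assms(2) by (intro mult_right_mono power_decreasing) auto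
  have s: "summable (\<lambda>n. (1 / 2) ^ (n * r) * (cmod (a n))\<^sup>2)"
    by (rule summable_comparison_test'[OF a(2)]) (use le in auto)
  then show "\<Phi> \<in> H_neg lam \<beta> r" by (simp add: a(1) dual_series_in_H_neg)
  show "H_norm lam \<beta> r \<Phi> \<le> H_norm lam \<beta> q \<Phi>"
    unfolding a(1) H_norm_dual_series by (intro real_sqrt_le_mono suminf_le le s a)
qed

lemma H_neg_lincomb:
  assumes "\<Phi> \<in> H_neg lam \<beta> q" "\<Psi> \<in> H_neg lam \<beta> q"
  shows "(\<lambda>f. x * \<Phi> f + y * \<Psi> f) \<in> H_neg lam \<beta> q"
proof -
  from assms(1) obtain a where a: "\<Phi> = dual_series lam \<beta> a"
    "summable (\<lambda>n. (1 / 2) ^ (n * q) * (cmod (a n))\<^sup>2)" by (rule H_negE)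
  from assms(2) obtain b where b: "\<Psi> = dual_series lam \<beta> b"
    "summable (\<lambda>n. (1 / 2) ^ (n * q) * (cmod (b n))\<^sup>2)" by (rule H_negE)
  have "summable (\<lambda>n. (1 / 2) ^ (n * q) * (cmod (x * a n + y * b n))\<^sup>2)"
  proof (rule summable_comparison_test')
    show "summable (\<lambda>n. 2 * (cmod x)\<^sup>2 * ((1 / 2) ^ (n * q) * (cmod (a n))\<^sup>2)
        + 2 * (cmod y)\<^sup>2 * ((1 / 2) ^ (n * q) * (cmod (b n))\<^sup>2))"
      by (intro summable_add summable_mult a b)
    fix n
    have "(cmod (x * a n + y * b n))\<^sup>2 \<le> (cmod (x * a n) + cmod (y * b n))\<^sup>2"
      by (intro power_mono norm_triangle_ineq) auto
    also have "\<dots> \<le> 2 * (cmod (x * a n))\<^sup>2 + 2 * (cmod (y * b n))\<^sup>2"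
      using sum_squares_bound[of "cmod (x * a n)" "cmod (y * b n)"] by (simp add: power2_sum)
    finally have "(1 / 2) ^ (n * q) * (cmod (x * a n + y * b n))\<^sup>2
        \<le> (1 / 2) ^ (n * q) * (2 * (cmod (x * a n))\<^sup>2 + 2 * (cmod (y * b n))\<^sup>2)"
      by (rule mult_left_mono) simp
    then show "norm ((1 / 2) ^ (n * q) * (cmod (x * a n + y * b n))\<^sup>2)
        \<le> 2 * (cmod x)\<^sup>2 * ((1 / 2) ^ (n * q) * (cmod (a n))\<^sup>2)
        + 2 * (cmod y)\<^sup>2 * ((1 / 2) ^ (n * q) * (cmod (b n))\<^sup>2)"
      by (simp add: norm_mult power_mult_distrib algebra_simps)
  qed
  then show ?thesis
    unfolding a(1) b(1) dual_series_linear[symmetric] dual_series_in_H_neg .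
qed

lemma H_norm_scale:
  assumes "\<Phi> \<in> H_neg lam \<beta> q"
  shows "H_norm lam \<beta> q (\<lambda>f. x * \<Phi> f) = cmod x * H_norm lam \<beta> q \<Phi>"
proof -
  from assms(1) obtain a where a: "\<Phi> = dual_series lam \<beta> a"
    "summable (\<lambda>n. (1 / 2) ^ (n * q) * (cmod (a n))\<^sup>2)" by (rule H_negE)
  have "(\<lambda>f. x * \<Phi> f) = dual_series lam \<beta> (\<lambda>n. x * a n)"
    using dual_series_linear[of x a 0 a] by (simp add: a(1))
  moreover have "(\<Sum>n. (1 / 2) ^ (n * q) * (cmod (x * a n))\<^sup>2)
      = (cmod x)\<^sup>2 * (\<Sum>n. (1 / 2) ^ (n * q) * (cmod (a n))\<^sup>2)"
    by (subst suminf_mult[OF a(2), symmetric]) (simp add: norm_mult power_mult_distrib mult_ac)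
  ultimately show ?thesis
    by (simp add: a(1) H_norm_dual_series real_sqrt_mult)
qed

lemma N_neg_lincomb:
  assumes "\<Phi> \<in> N_neg lam \<beta>" "\<Psi> \<in> N_neg lam \<beta>"
  shows "(\<lambda>f. x * \<Phi> f + y * \<Psi> f) \<in> N_neg lam \<beta>"
proof -
  from assms obtain q p where "\<Phi> \<in> H_neg lam \<beta> q" "\<Psi> \<in> H_neg lam \<beta> p"
    unfolding N_neg_def by blast
  then have "\<Phi> \<in> H_neg lam \<beta> (max q p)" "\<Psi> \<in> H_neg lam \<beta> (max q p)"
    using H_neg_mono(1) max.cobounded1 max.cobounded2 by blast+
  then show ?thesis using H_neg_lincomb unfolding N_neg_def by blast
qed

lemma N_neg_add: "\<Phi> \<in> N_neg lam \<beta> \<Longrightarrow> \<Psi> \<in> N_neg lam \<beta> \<Longrightarrow> (\<lambda>f. \<Phi> f + \<Psi> f) \<in> N_neg lam \<beta>"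
  using N_neg_lincomb[of \<Phi> \<Psi> 1 1] by simp

lemma N_negE:
  assumes "\<Phi> \<in> N_neg lam \<beta>"
  obtains q a where "\<Phi> = dual_series lam \<beta> a" "summable (\<lambda>n. (1 / 2) ^ (n * q) * (cmod (a n))\<^sup>2)"
  using assms unfolding N_neg_def H_neg_def by blast

lemma wick_N_neg: "\<Phi> \<in> N_neg lam \<beta> \<Longrightarrow> \<Psi> \<in> N_neg lam \<beta> \<Longrightarrow> wick lam \<beta> \<Phi> \<Psi> \<in> N_neg lam \<beta>"
  using wick_H_neg(1) unfolding N_neg_def by blast

lemma wick_lincomb_left:
  assumes "\<Phi> \<in> N_neg lam \<beta>" "\<Phi>' \<in> N_neg lam \<beta>" "\<Psi> \<in> N_neg lam \<beta>"
  shows "wick lam \<beta> (\<lambda>f. x * \<Phi> f + y * \<Phi>' f) \<Psi>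
    = (\<lambda>f. x * wick lam \<beta> \<Phi> \<Psi> f + y * wick lam \<beta> \<Phi>' \<Psi> f)"
proof -
  obtain q a where a: "\<Phi> = dual_series lam \<beta> a"
    "summable (\<lambda>n. (1 / 2) ^ (n * q) * (cmod (a n))\<^sup>2)" using assms(1) by (rule N_negE)
  obtain q' a' where a': "\<Phi>' = dual_series lam \<beta> a'"
    "summable (\<lambda>n. (1 / 2) ^ (n * q') * (cmod (a' n))\<^sup>2)" using assms(2) by (rule N_negE)
  obtain p b where b: "\<Psi> = dual_series lam \<beta> b"
    "summable (\<lambda>n. (1 / 2) ^ (n * p) * (cmod (b n))\<^sup>2)" using assms(3) by (rule N_negE)
  have lin: "(\<lambda>f. x * \<Phi> f + y * \<Phi>' f) = dual_series lam \<beta> (\<lambda>n. x * a n + y * a' n)"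
    unfolding a(1) a'(1) dual_series_linear ..
  \<comment> \<open>The combined sequence needs an index \<open>r\<close> of its own, since
    \<open>a\<close> and \<open>a'\<close> may have different ones and
    \<open>wick_dual_series\<close> asks for weighted summability.\<close>
  have "dual_series lam \<beta> (\<lambda>n. x * a n + y * a' n) \<in> N_neg lam \<beta>"
    unfolding lin[symmetric] by (intro N_neg_lincomb assms)
  then obtain r where r: "summable (\<lambda>n. (1 / 2) ^ (n * r) * (cmod (x * a n + y * a' n))\<^sup>2)"
    unfolding N_neg_def by (auto simp: dual_series_in_H_neg)
  have "convolution (\<lambda>n. x * a n + y * a' n) b = (\<lambda>n. x * convolution a b n + y * convolution a' b n)"
    by (simp add: convolution_def fun_eq_iff sum_distrib_left sum.distrib[symmetric] distrib_right mult.assoc)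
  then show ?thesis
    unfolding lin unfolding a(1) a'(1) b(1) wick_dual_series[OF r b(2)] wick_dual_series[OF a(2) b(2)]
      wick_dual_series[OF a'(2) b(2)] by (simp add: dual_series_linear)
qed

lemma wick_lincomb_right:
  assumes "\<Phi> \<in> N_neg lam \<beta>" "\<Phi>' \<in> N_neg lam \<beta>" "\<Psi> \<in> N_neg lam \<beta>"
  shows "wick lam \<beta> \<Psi> (\<lambda>f. x * \<Phi> f + y * \<Phi>' f)
    = (\<lambda>f. x * wick lam \<beta> \<Psi> \<Phi> f + y * wick lam \<beta> \<Psi> \<Phi>' f)"
  using wick_lincomb_left[OF assms] by (simp only: wick_commute[of lam \<beta> \<Psi>])

section \<open>Continuity in the inductive limit topology\<close>

lemma ind_lim_zero_nhdD:
  assumes "ind_lim_zero_nhd lam \<beta> V"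
  shows "V \<subseteq> N_neg lam \<beta>"
    and "\<And>\<Phi> \<Psi> a b. \<Phi> \<in> V \<Longrightarrow> \<Psi> \<in> V \<Longrightarrow> cmod a + cmod b \<le> 1 \<Longrightarrow> (\<lambda>f. a * \<Phi> f + b * \<Psi> f) \<in> V"
    and "\<And>q. \<exists>\<epsilon>>0. {\<Phi> \<in> H_neg lam \<beta> q. H_norm lam \<beta> q \<Phi> < \<epsilon>} \<subseteq> V"
  using assms unfolding ind_lim_zero_nhd_def absolutely_convex_def by blast+

lemma ind_lim_zero_nhd_N_neg: "ind_lim_zero_nhd lam \<beta> (N_neg lam \<beta>)"
  unfolding ind_lim_zero_nhd_def absolutely_convex_def
  using N_neg_lincomb by (auto simp: N_neg_def intro!: exI[of _ 1])

lemma zero_in_ind_lim_zero_nhd: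
  assumes "ind_lim_zero_nhd lam \<beta> V"
  shows "(\<lambda>f. 0) \<in> V"
proof -
  have zero: "(\<lambda>f. 0) \<in> H_neg lam \<beta> 0" "H_norm lam \<beta> 0 (\<lambda>f. 0) = 0"
  proof -
    have "dual_series lam \<beta> (\<lambda>n. 0) \<in> H_neg lam \<beta> 0"
      by (simp add: dual_series_in_H_neg)
    moreover have "dual_series lam \<beta> (\<lambda>n. 0) = (\<lambda>f. 0)"
      by (simp add: dual_series_def)
    ultimately show "(\<lambda>f. 0) \<in> H_neg lam \<beta> 0" by simp
    then show "H_norm lam \<beta> 0 (\<lambda>f. 0) = 0"
      using H_norm_scale[of "\<lambda>f. 0" 0 0] by simp
  qed
  with ind_lim_zero_nhdD(3)[OF assms, of 0] show ?thesis by auto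
qed

text \<open>Shrinking by c = 2 or c = 4 makes room for sums of several elements, which absolute
  convexity then returns to \<open>V\<close>.\<close>

lemma ind_lim_zero_nhd_scale:
  assumes V: "ind_lim_zero_nhd lam \<beta> V" and c: "c \<noteq> 0"
  shows "ind_lim_zero_nhd lam \<beta> {\<Phi> \<in> N_neg lam \<beta>. (\<lambda>f. c * \<Phi> f) \<in> V}" (is "ind_lim_zero_nhd _ _ ?U")
proof -
  have "absolutely_convex ?U"
    unfolding absolutely_convex_def
  proof (intro ballI allI impI)
    fix \<Phi> \<Psi> a b assume h: "\<Phi> \<in> ?U" "\<Psi> \<in> ?U" "cmod a + cmod b \<le> 1"
    then have "(\<lambda>f. a * (c * \<Phi> f) + b * (c * \<Psi> f)) \<in> V"
      by (intro ind_lim_zero_nhdD(2)[OF V]) auto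
    then have "(\<lambda>f. c * (a * \<Phi> f + b * \<Psi> f)) \<in> V"
      by (simp add: distrib_left mult.left_commute)
    with h show "(\<lambda>f. a * \<Phi> f + b * \<Psi> f) \<in> ?U"
      using N_neg_lincomb by blast
  qed
  moreover have "\<exists>\<epsilon>>0. {\<Phi> \<in> H_neg lam \<beta> q. H_norm lam \<beta> q \<Phi> < \<epsilon>} \<subseteq> ?U" for q
  proof -
    obtain e where e: "e > 0" "{\<Phi> \<in> H_neg lam \<beta> q. H_norm lam \<beta> q \<Phi> < e} \<subseteq> V"
      using ind_lim_zero_nhdD(3)[OF V] by blast
    have "\<Phi> \<in> ?U" if h: "\<Phi> \<in> H_neg lam \<beta> q" "H_norm lam \<beta> q \<Phi> < e / cmod c" for \<Phi>
    proof -
      have "H_norm lam \<beta> q (\<lambda>f. c * \<Phi> f) < e"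
        using h c by (simp add: H_norm_scale field_simps)
      moreover have "(\<lambda>f. c * \<Phi> f) \<in> H_neg lam \<beta> q"
        using H_neg_lincomb[OF h(1) h(1), of c 0] by simp
      ultimately show ?thesis using e h(1) by (auto simp: N_neg_def)
    qed
    then show ?thesis using e c by (intro exI[of _ "e / cmod c"]) auto
  qed
  ultimately show ?thesis unfolding ind_lim_zero_nhd_def by blast
qed

text \<open>The basic neighbourhoods need not be open, so \<open>A\<close> is taken as the interior
  of the translate of \<open>V\<close>.\<close>

lemma ind_lim_open_subset_translate:
  assumes V: "ind_lim_zero_nhd lam \<beta> V" and \<Phi>: "\<Phi> \<in> N_neg lam \<beta>"
  obtains A where "ind_lim_open lam \<beta> A" "\<Phi> \<in> A"
    "\<And>\<Theta>. \<Theta> \<in> A \<Longrightarrow> \<exists>\<Psi>\<in>V. \<Theta> = (\<lambda>f. \<Phi> f + \<Psi> f)"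
proof -
  define T where "T = {\<lambda>f. \<Phi> f + \<Psi> f |\<Psi>. \<Psi> \<in> V}"
  define A where "A = {\<Theta> \<in> N_neg lam \<beta>. \<exists>W. ind_lim_zero_nhd lam \<beta> W \<and> (\<forall>\<Psi>\<in>W. (\<lambda>f. \<Theta> f + \<Psi> f) \<in> T)}"
  show thesis
  proof
    show "ind_lim_open lam \<beta> A"
      unfolding ind_lim_open_def
    proof (intro conjI ballI)
      show "A \<subseteq> N_neg lam \<beta>" by (auto simp: A_def)
      fix \<Theta> assume "\<Theta> \<in> A"
      then obtain W where W: "ind_lim_zero_nhd lam \<beta> W" "\<forall>\<Psi>\<in>W. (\<lambda>f. \<Theta> f + \<Psi> f) \<in> T"
        and \<Theta>: "\<Theta> \<in> N_neg lam \<beta>" by (auto simp: A_def)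
      \<comment> \<open>Half of \<open>W\<close>: a sum of two elements of \<open>W2\<close> lies in
        \<open>W\<close>, so every point reached from \<Theta> through \<open>W2\<close> is again
        interior.\<close>
      define W2 where "W2 = {\<Psi> \<in> N_neg lam \<beta>. (\<lambda>f. 2 * \<Psi> f) \<in> W}"
      have W2: "ind_lim_zero_nhd lam \<beta> W2"
        unfolding W2_def by (rule ind_lim_zero_nhd_scale[OF W(1)]) simp
      have "(\<lambda>f. \<Theta> f + \<Psi> f) \<in> A" if \<Psi>: "\<Psi> \<in> W2" for \<Psi>
      proof -
        have "(\<lambda>f. \<Theta> f + \<Psi> f) \<in> N_neg lam \<beta>"
          using \<Theta> \<Psi> by (intro N_neg_add) (auto simp: W2_def)
        moreover have "(\<lambda>f. \<Theta> f + \<Psi> f + \<Xi> f) \<in> T" if \<Xi>: "\<Xi> \<in> W2" for \<Xi>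
        proof -
          have "(\<lambda>f. (1 / 2) * (2 * \<Psi> f) + (1 / 2) * (2 * \<Xi> f)) \<in> W"
            using \<Psi> \<Xi> by (intro ind_lim_zero_nhdD(2)[OF W(1)]) (auto simp: W2_def norm_divide)
          then have "(\<lambda>f. \<Psi> f + \<Xi> f) \<in> W" by simp
          then have "(\<lambda>f. \<Theta> f + (\<Psi> f + \<Xi> f)) \<in> T" by (rule bspec[OF W(2)])
          then show ?thesis by (simp add: add.assoc)
        qed
        ultimately show ?thesis using W2 unfolding A_def by blast
      qed
      with W2 show "\<exists>V. ind_lim_zero_nhd lam \<beta> V \<and> (\<forall>\<Psi>\<in>V. (\<lambda>f. \<Theta> f + \<Psi> f) \<in> A)" by blast
    qed
    show "\<Phi> \<in> A" using V \<Phi> by (auto simp: A_def T_def)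
    fix \<Theta> assume "\<Theta> \<in> A"
    then obtain W where W: "ind_lim_zero_nhd lam \<beta> W" "\<forall>\<Psi>\<in>W. (\<lambda>f. \<Theta> f + \<Psi> f) \<in> T"
      by (auto simp: A_def)
    have "(\<lambda>f. \<Theta> f + 0) \<in> T"
      by (rule bspec[OF W(2) zero_in_ind_lim_zero_nhd[OF W(1)]])
    then show "\<exists>\<Psi>\<in>V. \<Theta> = (\<lambda>f. \<Phi> f + \<Psi> f)" by (auto simp: T_def)
  qed
qed

text \<open>The witness is the intersection of all absolutely convex sets containing the prescribed
  balls. Its minimality reduces an inclusion in an absolutely convex set to a check on
  balls.\<close>

lemma ind_lim_zero_nhd_hull:
  fixes \<delta> :: "nat \<Rightarrow> real"
  assumes "\<And>q. \<delta> q > 0"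
  obtains V where "ind_lim_zero_nhd lam \<beta> V"
    "\<And>U. U \<subseteq> N_neg lam \<beta> \<Longrightarrow> absolutely_convex U \<Longrightarrow>
       (\<And>q \<Phi>. \<Phi> \<in> H_neg lam \<beta> q \<Longrightarrow> H_norm lam \<beta> q \<Phi> < \<delta> q \<Longrightarrow> \<Phi> \<in> U) \<Longrightarrow> V \<subseteq> U"
proof -
  define \<U> where "\<U> = {U. U \<subseteq> N_neg lam \<beta> \<and> absolutely_convex U \<and>
      (\<forall>q. {\<Phi> \<in> H_neg lam \<beta> q. H_norm lam \<beta> q \<Phi> < \<delta> q} \<subseteq> U)}"
  have "N_neg lam \<beta> \<in> \<U>"
    using ind_lim_zero_nhd_N_neg by (auto simp: \<U>_def ind_lim_zero_nhd_def N_neg_def)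
  moreover have "absolutely_convex (\<Inter>\<U>)"
    unfolding absolutely_convex_def
  proof (intro ballI allI impI InterI)
    fix \<Phi> \<Psi> a b U assume "\<Phi> \<in> \<Inter>\<U>" "\<Psi> \<in> \<Inter>\<U>" "cmod a + cmod b \<le> 1" "U \<in> \<U>"
    moreover from this have "\<Phi> \<in> U" "\<Psi> \<in> U" "absolutely_convex U" by (auto simp: \<U>_def)
    ultimately show "(\<lambda>f. a * \<Phi> f + b * \<Psi> f) \<in> U" unfolding absolutely_convex_def by blast
  qed
  moreover have "{\<Phi> \<in> H_neg lam \<beta> q. H_norm lam \<beta> q \<Phi> < \<delta> q} \<subseteq> \<Inter>\<U>" for q
    by (auto simp: \<U>_def)
  ultimately have "ind_lim_zero_nhd lam \<beta> (\<Inter>\<U>)"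
    unfolding ind_lim_zero_nhd_def using assms by blast
  then show thesis
    by (rule that) (auto simp: \<U>_def)
qed

section \<open>Joint continuity of the product\<close>

lemma absolutely_convex_wick_left:
  assumes W: "ind_lim_zero_nhd lam \<beta> W" and "\<Psi> \<in> N_neg lam \<beta>"
  shows "absolutely_convex {\<Phi> \<in> N_neg lam \<beta>. wick lam \<beta> \<Phi> \<Psi> \<in> W}"
  unfolding absolutely_convex_def
  using assms(2) by (auto simp: N_neg_lincomb wick_lincomb_left intro: ind_lim_zero_nhdD(2)[OF W])

lemma absolutely_convex_wick_right:
  assumes W: "ind_lim_zero_nhd lam \<beta> W" and "\<Phi> \<in> N_neg lam \<beta>"
  shows "absolutely_convex {\<Psi> \<in> N_neg lam \<beta>. wick lam \<beta> \<Phi> \<Psi> \<in> W}"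
  unfolding absolutely_convex_def
  using assms(2) by (auto simp: N_neg_lincomb wick_lincomb_right intro: ind_lim_zero_nhdD(2)[OF W])

lemma H_norm_nonneg: "\<Phi> \<in> H_neg lam \<beta> q \<Longrightarrow> H_norm lam \<beta> q \<Phi> \<ge> 0"
  by (auto elim!: H_negE simp: H_norm_dual_series intro!: suminf_nonneg)

text \<open>These are the three error terms of a product expanded around (\<Phi>0, \<Psi>0). With
  \<open>V\<close> a hull of balls, each inclusion reduces to the norm estimate on balls.\<close>

lemma wick_small:
  assumes W: "ind_lim_zero_nhd lam \<beta> W" and \<Phi>0: "\<Phi>0 \<in> N_neg lam \<beta>" and \<Psi>0: "\<Psi>0 \<in> N_neg lam \<beta>"
  obtains V where "ind_lim_zero_nhd lam \<beta> V"
    "\<And>\<Phi> \<Psi>. \<Phi> \<in> V \<Longrightarrow> \<Psi> \<in> V \<Longrightarrow>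
      wick lam \<beta> \<Phi>0 \<Psi> \<in> W \<and> wick lam \<beta> \<Phi> \<Psi>0 \<in> W \<and> wick lam \<beta> \<Phi> \<Psi> \<in> W"
proof -
  obtain s where s: "\<Phi>0 \<in> H_neg lam \<beta> s" using \<Phi>0 unfolding N_neg_def by blast
  obtain t where t: "\<Psi>0 \<in> H_neg lam \<beta> t" using \<Psi>0 unfolding N_neg_def by blast
  define M where "M = H_norm lam \<beta> s \<Phi>0"
  define K where "K = H_norm lam \<beta> t \<Psi>0"
  have MK: "M \<ge> 0" "K \<ge> 0" using s t by (auto simp: M_def K_def H_norm_nonneg)
  obtain \<epsilon> where \<epsilon>: "\<And>q. \<epsilon> q > 0"
    "\<And>q \<Phi>. \<Phi> \<in> H_neg lam \<beta> q \<Longrightarrow> H_norm lam \<beta> q \<Phi> < \<epsilon> q \<Longrightarrow> \<Phi> \<in> W"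
    using ind_lim_zero_nhdD(3)[OF W] by (metis (mono_tags, lifting) mem_Collect_eq subset_iff)
  \<comment> \<open>For \<open>p \<le> q\<close> the product of the \<open>q\<close>-ball and the \<open>p\<close>-ball lies in the ball of radius
    \<open>\<delta> q \<le> \<epsilon> (2 * q + 1)\<close> of the space with index \<open>2 * q + 1 \<ge> p + q + 1\<close>.\<close>
  define \<delta> where "\<delta> q = min (min 1 (\<epsilon> (2 * q + 1)))
      (min (\<epsilon> (q + s + 1) / (1 + M)) (\<epsilon> (t + q + 1) / (1 + K)))" for q
  have \<delta>: "\<delta> q > 0" "\<delta> q \<le> 1" "\<delta> q \<le> \<epsilon> (2 * q + 1)"
    "(1 + M) * \<delta> q \<le> \<epsilon> (q + s + 1)" "\<delta> q * (1 + K) \<le> \<epsilon> (t + q + 1)" for q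
  proof -
    have "\<delta> q \<le> \<epsilon> (q + s + 1) / (1 + M)" "\<delta> q \<le> \<epsilon> (t + q + 1) / (1 + K)"
      by (simp_all add: \<delta>_def)
    then show "(1 + M) * \<delta> q \<le> \<epsilon> (q + s + 1)" "\<delta> q * (1 + K) \<le> \<epsilon> (t + q + 1)"
      using MK by (simp_all add: pos_le_divide_eq mult.commute)
    show "\<delta> q > 0" "\<delta> q \<le> 1" "\<delta> q \<le> \<epsilon> (2 * q + 1)" using \<epsilon>(1) MK by (auto simp: \<delta>_def)
  qed
  obtain V where V: "ind_lim_zero_nhd lam \<beta> V"
    "\<And>U. U \<subseteq> N_neg lam \<beta> \<Longrightarrow> absolutely_convex U \<Longrightarrow>
       (\<And>q \<Phi>. \<Phi> \<in> H_neg lam \<beta> q \<Longrightarrow> H_norm lam \<beta> q \<Phi> < \<delta> q \<Longrightarrow> \<Phi> \<in> U) \<Longrightarrow> V \<subseteq> U"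
    using ind_lim_zero_nhd_hull[of \<delta>, OF \<delta>(1)] by blast
  have in_N: "\<Phi> \<in> N_neg lam \<beta>" if "\<Phi> \<in> H_neg lam \<beta> q" for \<Phi> q
    using that by (auto simp: N_neg_def)
  have "V \<subseteq> {\<Psi> \<in> N_neg lam \<beta>. wick lam \<beta> \<Phi>0 \<Psi> \<in> W}"
  proof (rule V(2))
    fix q \<Psi> assume \<Psi>: "\<Psi> \<in> H_neg lam \<beta> q" "H_norm lam \<beta> q \<Psi> < \<delta> q"
    have "H_norm lam \<beta> (q + s + 1) (wick lam \<beta> \<Phi>0 \<Psi>) \<le> M * H_norm lam \<beta> q \<Psi>"
      unfolding M_def by (rule wick_H_neg(2)[OF s \<Psi>(1)])
    also have "\<dots> \<le> M * \<delta> q" using \<Psi> MK by (intro mult_left_mono) auto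
    \<comment> \<open>Taking 1 + M in place of M gives a strict inequality and a positive divisor
      even when \<Phi>0 is zero.\<close>
    also have "\<dots> < (1 + M) * \<delta> q" using \<delta>(1)[of q] by (simp add: distrib_right)
    also have "\<dots> \<le> \<epsilon> (q + s + 1)" by (rule \<delta>)
    finally show "\<Psi> \<in> {\<Psi> \<in> N_neg lam \<beta>. wick lam \<beta> \<Phi>0 \<Psi> \<in> W}"
      using \<epsilon>(2) wick_H_neg(1)[OF s \<Psi>(1)] in_N[OF \<Psi>(1)] by blast
  qed (use absolutely_convex_wick_right[OF W \<Phi>0] in auto)
  moreover have "V \<subseteq> {\<Phi> \<in> N_neg lam \<beta>. wick lam \<beta> \<Phi> \<Psi>0 \<in> W}"
  proof (rule V(2))
    fix q \<Phi> assume \<Phi>: "\<Phi> \<in> H_neg lam \<beta> q" "H_norm lam \<beta> q \<Phi> < \<delta> q"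
    have "H_norm lam \<beta> (t + q + 1) (wick lam \<beta> \<Phi> \<Psi>0) \<le> H_norm lam \<beta> q \<Phi> * K"
      unfolding K_def by (rule wick_H_neg(2)[OF \<Phi>(1) t])
    also have "\<dots> \<le> \<delta> q * K" using \<Phi> MK by (intro mult_right_mono) auto
    also have "\<dots> < \<delta> q * (1 + K)" using \<delta>(1)[of q] by (simp add: distrib_left)
    also have "\<dots> \<le> \<epsilon> (t + q + 1)" by (rule \<delta>)
    finally show "\<Phi> \<in> {\<Phi> \<in> N_neg lam \<beta>. wick lam \<beta> \<Phi> \<Psi>0 \<in> W}"
      using \<epsilon>(2) wick_H_neg(1)[OF \<Phi>(1) t] in_N[OF \<Phi>(1)] by blast
  qed (use absolutely_convex_wick_left[OF W \<Psi>0] in auto)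
  moreover have balls: "wick lam \<beta> \<Phi> \<Psi> \<in> W"
    if \<Phi>: "\<Phi> \<in> H_neg lam \<beta> q" "H_norm lam \<beta> q \<Phi> < \<delta> q"
      and \<Psi>: "\<Psi> \<in> H_neg lam \<beta> p" "H_norm lam \<beta> p \<Psi> < \<delta> p" for \<Phi> \<Psi> q p
  proof -
    define r where "r = max q p"
    have r: "p + q + 1 \<le> 2 * r + 1" by (simp add: r_def)
    note mem = H_neg_mono(1)[OF wick_H_neg(1)[OF \<Phi>(1) \<Psi>(1)] r]
    have "H_norm lam \<beta> (2 * r + 1) (wick lam \<beta> \<Phi> \<Psi>) \<le> H_norm lam \<beta> (p + q + 1) (wick lam \<beta> \<Phi> \<Psi>)"
      by (rule H_neg_mono(2)[OF wick_H_neg(1)[OF \<Phi>(1) \<Psi>(1)] r])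
    also have "H_norm lam \<beta> (p + q + 1) (wick lam \<beta> \<Phi> \<Psi>) \<le> H_norm lam \<beta> q \<Phi> * H_norm lam \<beta> p \<Psi>"
      by (rule wick_H_neg(2)[OF \<Phi>(1) \<Psi>(1)])
    also have "\<dots> < \<delta> q * \<delta> p"
      using \<Phi> \<Psi> by (intro mult_strict_mono' H_norm_nonneg)
    \<comment> \<open>One of the two factors is \<delta> r and the other is at most 1.\<close>
    also have "\<dots> \<le> \<delta> r"
      using \<delta>(1,2)[of q] \<delta>(1,2)[of p] by (auto simp: r_def max_def mult_left_le mult_left_le_one_le)
    also have "\<dots> \<le> \<epsilon> (2 * r + 1)" by (rule \<delta>)
    finally show ?thesis using \<epsilon>(2) mem by blast
  qed
  \<comment> \<open>The hull is used twice: in the left factor while the right one lies in a ball,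
    then in the right factor while the left one ranges over \<open>V\<close>.\<close>
  moreover have "V \<subseteq> {\<Phi> \<in> N_neg lam \<beta>. wick lam \<beta> \<Phi> \<Psi> \<in> W}"
    if \<Psi>: "\<Psi> \<in> H_neg lam \<beta> p" "H_norm lam \<beta> p \<Psi> < \<delta> p" for p \<Psi>
    using balls[OF _ _ \<Psi>] in_N absolutely_convex_wick_left[OF W in_N[OF \<Psi>(1)]]
    by (intro V(2)) auto
  then have "V \<subseteq> {\<Psi> \<in> N_neg lam \<beta>. wick lam \<beta> \<Phi> \<Psi> \<in> W}" if "\<Phi> \<in> V" for \<Phi>
    using that in_N absolutely_convex_wick_right[OF W] ind_lim_zero_nhdD(1)[OF V(1)]
    by (intro V(2)) blast+
  ultimately show thesis by (intro that[OF V(1)]) blast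
qed

lemma topspace_ind_lim_topology: "topspace (ind_lim_topology lam \<beta>) = N_neg lam \<beta>"
proof -
  have "ind_lim_open lam \<beta> (N_neg lam \<beta>)"
    unfolding ind_lim_open_def using ind_lim_zero_nhd_N_neg N_neg_add by blast
  then show ?thesis
    unfolding topspace_def openin_ind_lim_topology by (auto simp: ind_lim_open_def)
qed

lemma continuous_map_wick:
  "continuous_map (prod_topology (ind_lim_topology lam \<beta>) (ind_lim_topology lam \<beta>))
     (ind_lim_topology lam \<beta>) (\<lambda>(\<Phi>, \<Psi>). wick lam \<beta> \<Phi> \<Psi>)"
  unfolding continuous_map topspace_prod_topology topspace_ind_lim_topology openin_prod_topology_alt
    openin_ind_lim_topology
proof (intro conjI allI impI)
  show "(\<lambda>(\<Phi>, \<Psi>). wick lam \<beta> \<Phi> \<Psi>) ` (N_neg lam \<beta> \<times> N_neg lam \<beta>) \<subseteq> N_neg lam \<beta>"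
    using wick_N_neg by auto
next
  fix U \<Phi>0 \<Psi>0
  assume U: "ind_lim_open lam \<beta> U"
    and "(\<Phi>0, \<Psi>0) \<in> {x \<in> N_neg lam \<beta> \<times> N_neg lam \<beta>. (case x of (\<Phi>, \<Psi>) \<Rightarrow> wick lam \<beta> \<Phi> \<Psi>) \<in> U}"
  then have \<Phi>0: "\<Phi>0 \<in> N_neg lam \<beta>" and \<Psi>0: "\<Psi>0 \<in> N_neg lam \<beta>" and "wick lam \<beta> \<Phi>0 \<Psi>0 \<in> U"
    by auto
  then obtain W where W: "ind_lim_zero_nhd lam \<beta> W"
    "\<And>\<Psi>. \<Psi> \<in> W \<Longrightarrow> (\<lambda>f. wick lam \<beta> \<Phi>0 \<Psi>0 f + \<Psi> f) \<in> U"
    using U unfolding ind_lim_open_def by blast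
  \<comment> \<open>A quarter of \<open>W\<close> leaves room for the sum of the three error
    terms.\<close>
  define W4 where "W4 = {\<Phi> \<in> N_neg lam \<beta>. (\<lambda>f. 4 * \<Phi> f) \<in> W}"
  have "ind_lim_zero_nhd lam \<beta> W4"
    unfolding W4_def by (rule ind_lim_zero_nhd_scale[OF W(1)]) simp
  then obtain V where V: "ind_lim_zero_nhd lam \<beta> V"
    "\<And>\<Phi> \<Psi>. \<Phi> \<in> V \<Longrightarrow> \<Psi> \<in> V \<Longrightarrow>
      wick lam \<beta> \<Phi>0 \<Psi> \<in> W4 \<and> wick lam \<beta> \<Phi> \<Psi>0 \<in> W4 \<and> wick lam \<beta> \<Phi> \<Psi> \<in> W4"
    using wick_small[OF _ \<Phi>0 \<Psi>0] by blast
  obtain A where A: "ind_lim_open lam \<beta> A" "\<Phi>0 \<in> A" "\<And>\<Theta>. \<Theta> \<in> A \<Longrightarrow> \<exists>\<Psi>\<in>V. \<Theta> = (\<lambda>f. \<Phi>0 f + \<Psi> f)"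
    using ind_lim_open_subset_translate[OF V(1) \<Phi>0] by blast
  obtain B where B: "ind_lim_open lam \<beta> B" "\<Psi>0 \<in> B" "\<And>\<Theta>. \<Theta> \<in> B \<Longrightarrow> \<exists>\<Psi>\<in>V. \<Theta> = (\<lambda>f. \<Psi>0 f + \<Psi> f)"
    using ind_lim_open_subset_translate[OF V(1) \<Psi>0] by blast
  have "wick lam \<beta> \<Phi>1 \<Psi>1 \<in> U" if mem: "\<Phi>1 \<in> A" "\<Psi>1 \<in> B" for \<Phi>1 \<Psi>1
  proof -
    obtain \<Phi> where \<Phi>: "\<Phi> \<in> V" "\<Phi>1 = (\<lambda>f. \<Phi>0 f + \<Phi> f)" using A(3)[OF mem(1)] by (rule bexE)
    obtain \<Psi> where \<Psi>: "\<Psi> \<in> V" "\<Psi>1 = (\<lambda>f. \<Psi>0 f + \<Psi> f)" using B(3)[OF mem(2)] by (rule bexE)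
    have N: "\<Phi> \<in> N_neg lam \<beta>" "\<Psi> \<in> N_neg lam \<beta>" "\<Psi>1 \<in> N_neg lam \<beta>"
      using \<Phi> \<Psi> ind_lim_zero_nhdD(1)[OF V(1)] \<Psi>0 N_neg_add by auto
    let ?x = "wick lam \<beta> \<Phi>0 \<Psi>" and ?y = "wick lam \<beta> \<Phi> \<Psi>0" and ?z = "wick lam \<beta> \<Phi> \<Psi>"
    have W4: "(\<lambda>f. 4 * ?x f) \<in> W" "(\<lambda>f. 4 * ?y f) \<in> W" "(\<lambda>f. 4 * ?z f) \<in> W"
      using V(2)[OF \<Phi>(1) \<Psi>(1)] by (auto simp: W4_def)
    have "(\<lambda>f. (1 / 2) * (4 * ?y f) + (1 / 2) * (4 * ?z f)) \<in> W"
      using W4 by (intro ind_lim_zero_nhdD(2)[OF W(1)]) (auto simp: norm_divide)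
    \<comment> \<open>Absolute convexity is binary, so it is applied twice; the coefficients here
      add up to 3/4, and the factors 4 cancel to leave the plain sum.\<close>
    then have "(\<lambda>f. (1 / 4) * (4 * ?x f) + (1 / 2) * ((1 / 2) * (4 * ?y f) + (1 / 2) * (4 * ?z f))) \<in> W"
      using W4 by (intro ind_lim_zero_nhdD(2)[OF W(1)]) (auto simp: norm_divide)
    then have "(\<lambda>f. ?x f + (?y f + ?z f)) \<in> W"
      by (simp add: add_divide_distrib)
    then have "(\<lambda>f. wick lam \<beta> \<Phi>0 \<Psi>0 f + (?x f + (?y f + ?z f))) \<in> U"
      by (rule W(2))
    moreover have "wick lam \<beta> \<Phi>1 \<Psi>1 = (\<lambda>f. wick lam \<beta> \<Phi>0 \<Psi>1 f + wick lam \<beta> \<Phi> \<Psi>1 f)"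
      using wick_lincomb_left[of \<Phi>0 \<Phi> \<Psi>1 1 1] \<Phi>0 N by (simp add: \<Phi>(2))
    moreover have "wick lam \<beta> \<Theta> \<Psi>1 = (\<lambda>f. wick lam \<beta> \<Theta> \<Psi>0 f + wick lam \<beta> \<Theta> \<Psi> f)"
      if "\<Theta> \<in> N_neg lam \<beta>" for \<Theta>
      using wick_lincomb_right[of \<Psi>0 \<Psi> \<Theta> 1 1] \<Psi>0 N that by (simp add: \<Psi>(2))
    ultimately show ?thesis using \<Phi>0 N by (simp add: add_ac)
  qed
  then show "\<exists>A B. ind_lim_open lam \<beta> A \<and> ind_lim_open lam \<beta> B \<and> \<Phi>0 \<in> A \<and> \<Psi>0 \<in> B \<and>
      A \<times> B \<subseteq> {x \<in> N_neg lam \<beta> \<times> N_neg lam \<beta>. (case x of (\<Phi>, \<Psi>) \<Rightarrow> wick lam \<beta> \<Phi> \<Psi>) \<in> U}"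
    using A(1,2) B(1,2) by (intro exI[of _ A] exI[of _ B]) (auto simp: ind_lim_open_def)
qed

end

theorem proposition7p1:
  fixes lam \<beta> :: real
  assumes "lam > 0" and "0 < \<beta>" and "\<beta> \<le> 1"
  shows "continuous_map
           (prod_topology (ind_lim_topology lam \<beta>) (ind_lim_topology lam \<beta>))
           (ind_lim_topology lam \<beta>)
           (\<lambda>(\<Phi>, \<Psi>). wick lam \<beta> \<Phi> \<Psi>)
       \<and> (\<forall>p q. \<forall>\<Phi>\<in>H_neg lam \<beta> q. \<forall>\<Psi>\<in>H_neg lam \<beta> p.
            wick lam \<beta> \<Phi> \<Psi> \<in> H_neg lam \<beta> (p + q + 1) \<and>
            H_norm lam \<beta> (p + q + 1) (wick lam \<beta> \<Phi> \<Psi>)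
              \<le> H_norm lam \<beta> q \<Phi> * H_norm lam \<beta> p \<Psi>)"
proof -
  interpret frac_poisson_params lam \<beta>
    using assms by unfold_locales
  show ?thesis using continuous_map_wick wick_H_neg by blast
qed

end
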